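(* Let $Y_\star\in\mathcal{M}_4\cap\mathrm{Sym}(\mathbb{R}^{n\times n})$ be a stationary point of the rank-4 ODE \[ \dot Y=-P_YR_\varepsilon(E)+\langle P_YR_\varepsilon(E),E\rangle Y,\qquad E=\Pi_{\mathcal{S}}Y . \] Assume the following: - $E_\star=\Pi_{\mathcal{S}}Y_\star\in\mathcal{E}_1$; - $\lambda_k$ and $\lambda_{k+1}$ of $L(W+\varepsilon E_\star)$ are simple; - $R_\varepsilon(E_\star)$ has rank 4; - $P_{Y_\star}R_\varepsilon(E_\star)\neq0$. Then there exist $\delta_\star>0$ and a constant $C>0$ such that for every symmetric $\hat Y\in\mathcal{M}_4$ with $\|\hat Y-Y_\star\|_F=\delta<\delta_\star$ and $\hat E=\Pi_{\mathcal{S}}\hat Y\in\mathcal{E}_1$, one has \[ \|P_{\hat Y}R_\varepsilon(\hat E)-R_\varepsilon(\hat E)\|_F\le C\delta^2 . \]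
   Context: Let $\mathscr{E}\subseteq\{1,\dots,n\}^2$ be a symmetric edge set, and let $W\in\mathbb{R}^{n\times n}$ be symmetric, entrywise non-negative, with $w_{ij}=0$ for $(i,j)\notin\mathscr{E}$. Let $L(A)=\mathrm{diag}(A\mathbb{1})-A$ with $\mathbb{1}=(1,\dots,1)^T$. Eigenvalues are ordered $\lambda_1\le\dots\le\lambda_n$. The inner product is $\langle X,Y\rangle=\mathrm{trace}(X^TY)$ and $\|\cdot\|_F$ is the Frobenius norm. Let $\mathcal{S}=\{A: a_{ij}=0\ \forall (i,j)\notin\mathscr{E}\}$, with orthogonal projection $\Pi_{\mathcal{S}}$ (zeroing the entries outside $\mathscr{E}$). Let $\mathcal{E}=\mathcal{S}\cap\mathrm{Sym}(\mathbb{R}^{n\times n})$ and $\mathcal{E}_1=\{E\in\mathcal{E}:\|E\|_F=1\}$. Fix $k\in\{2,\dots,n-1\}$ and $\varepsilon>0$. For $E\in\mathcal{E}$ with $\lambda_k,\lambda_{k+1}$ of $L(W+\varepsilon E)$ simple, let $x$ and $y$ be unit eigenvectors for $\lambda_{k+1}$ and $\lambda_k$ respectively. Set $z=x\bullet x-y\bullet y$ (componentwise product) and $R_\varepsilon(E)=\tfrac12(z\mathbb{1}^T+\mathbb{1}z^T)-xx^T+yy^T$. $\mathcal{M}_4$ is the manifold of real $n\times n$ matrices of rank exactly 4. $P_Y$ is the orthogonal projection onto $T_Y\mathcal{M}_4$. For symmetric $Y=USU^T$, with $U\in\mathbb{R}^{n\times4}$ having orthonormal columns and $S$ symmetric invertible,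 it is $P_YA=A-(I_n-UU^T)A(I_n-UU^T)$. A stationary point is a zero of the right-hand side of the ODE. *)

theory Defs
  imports "HOL-Analysis.Analysis" "HOL-Library.Multiset"
begin

text \<open>All matrices are n x n real matrices, n = CARD('n); indices are the elements of the finite type 'n.\<close>

type_synonym 'n mat = "real^'n^'n"

definition symm :: "'n::finite mat \<Rightarrow> bool" where
  "symm A \<longleftrightarrow> transpose A = A"

text \<open>Frobenius inner product and norm: <X,Y> = trace(X^T Y).\<close>
definition frob_inner :: "'n::finite mat \<Rightarrow> 'n mat \<Rightarrow> real" where
  "frob_inner X Y = trace (transpose X ** Y)"

definition frob_norm :: "'n::finite mat \<Rightarrow> real" where
  "frob_norm X = sqrt (frob_inner X X)"

text \<open>Graph Laplacian L(A) = diag(A 1) - A.\<close>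
definition laplacian :: "'n::finite mat \<Rightarrow> 'n mat" where
  "laplacian A = (\<chi> i j. if i = j then (\<Sum>l\<in>UNIV. A$i$l) else 0) - A"

text \<open>Eigenvalues counted with multiplicity (dimension of the eigenspace; for symmetric
  matrices this equals the algebraic multiplicity), sorted increasingly; lam A j is the
  j-th one, 1-indexed: lam A 1 \<le> ... \<le> lam A n.\<close>
definition eigenspace :: "'n::finite mat \<Rightarrow> real \<Rightarrow> (real^'n) set" where
  "eigenspace A \<mu> = {v. A *v v = \<mu> *\<^sub>R v}"

definition eig_mset :: "'n::finite mat \<Rightarrow> real multiset" where
  "eig_mset A = (\<Sum>\<mu>\<in>{\<mu>. \<exists>v. v \<noteq> 0 \<and> A *v v = \<mu> *\<^sub>R v}.
                    replicate_mset (dim (eigenspace A \<mu>)) \<mu>)"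

definition lam :: "'n::finite mat \<Rightarrow> nat \<Rightarrow> real" where
  "lam A j = sorted_list_of_multiset (eig_mset A) ! (j - 1)"

definition simple_eig :: "'n::finite mat \<Rightarrow> nat \<Rightarrow> bool" where
  "simple_eig A j \<longleftrightarrow> count (eig_mset A) (lam A j) = 1"

text \<open>Projection onto the sparsity pattern S (zero entries outside the edge set).\<close>
definition PiS :: "('n \<times> 'n) set \<Rightarrow> 'n::finite mat \<Rightarrow> 'n mat" where
  "PiS Es A = (\<chi> i j. if (i, j) \<in> Es then A$i$j else 0)"

definition inS :: "('n \<times> 'n) set \<Rightarrow> 'n::finite mat \<Rightarrow> bool" where
  "inS Es A \<longleftrightarrow> (\<forall>i j. (i, j) \<notin> Es \<longrightarrow> A$i$j = 0)"

text \<open>calE_1 = {E in S, E symmetric, ||E||_F = 1}.\<close>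
definition calE1 :: "('n \<times> 'n) set \<Rightarrow> 'n::finite mat set" where
  "calE1 Es = {E. inS Es E \<and> symm E \<and> frob_norm E = 1}"

text \<open>R_eps(E): x, y unit eigenvectors of L(W + eps E) for lambda_{k+1}, lambda_k
  (well defined up to sign when these eigenvalues are simple).\<close>
definition Rmat :: "nat \<Rightarrow> 'n::finite mat \<Rightarrow> real \<Rightarrow> 'n mat \<Rightarrow> 'n mat" where
  "Rmat k W \<epsilon> E =
     (let A = laplacian (W + \<epsilon> *\<^sub>R E);
          x = (SOME x::real^'n. norm x = 1 \<and> A *v x = lam A (k + 1) *\<^sub>R x);
          y = (SOME y::real^'n. norm y = 1 \<and> A *v y = lam A k *\<^sub>R y);
          z = (\<chi> i. x$i * x$i - y$i * y$i)
      in (\<chi> i j. (z$i + z$j) / 2 - x$i * x$j + y$i * y$j))"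

text \<open>Tangent-space projection P_Y for symmetric Y = U S U^T of rank 4,
  U with 4 orthonormal columns, S symmetric invertible:
  P_Y A = A - (I - U U^T) A (I - U U^T).\<close>
definition PY :: "'n::finite mat \<Rightarrow> 'n mat \<Rightarrow> 'n mat" where
  "PY Y A =
     (let U = (SOME U::real^4^'n. transpose U ** U = mat 1 \<and>
                 (\<exists>S::real^4^4. transpose S = S \<and> invertible S \<and> Y = U ** S ** transpose U));
          Q = mat 1 - U ** transpose U
      in A - Q ** A ** Q)"

text \<open>Right-hand side of the rank-4 ODE at Y, with E = Pi_S Y.\<close>
definition ode_rhs :: "('n \<times> 'n) set \<Rightarrow> nat \<Rightarrow> 'n::finite mat \<Rightarrow> real \<Rightarrow> 'n mat \<Rightarrow> 'n mat" where
  "ode_rhs Es k W \<epsilon> Y =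
     (let E = PiS Es Y; G = PY Y (Rmat k W \<epsilon> E)
      in - G + frob_inner G E *\<^sub>R Y)"

end

theory Submission
  imports Defs
begin

text \<open>At the stationary point P_Y R = \<gamma> Y with \<gamma> \<noteq> 0, and since R and Y both have rank 4
  this forces R = \<gamma> Y. Hence the four vectors z, 1, x, y from which R is assembled lie in the
  range of Y. For a nearby Y' the simple eigenvectors x', y' of L(W + \<epsilon> E') move by O(\<delta>)
  (Weyl's inequality and the Davis--Kahan bound), so all four vectors of R' lie within O(\<delta>) of
  the range of Y and therefore within O(\<delta>) of the range of Y'. Finally P_Y' R' - R' = -Q R' Q,
  where Q projects onto the orthogonal complement of that range, and Q R' Q is a sum of outer
  products of the Q-images of these vectors, hence O(\<delta>^2).\<close>

section \<open>Spectral theorem for symmetric matrices\<close>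

lemma symmetric_matrix_inner_commute:
  fixes A :: "real^'n::finite^'n"
  assumes "transpose A = A"
  shows "(A *v u) \<bullet> w = u \<bullet> (A *v w)"
  by (metis assms dot_lmul_matrix transpose_matrix_vector)

lemma linear_le_quadratic_imp_zero:
  fixes a c :: real
  assumes "\<And>t. 2 * t * a \<le> t\<^sup>2 * c"
  shows "a = 0"
proof -
  define d where "d = \<bar>c\<bar> + 1"
  have d: "d > 0" "c \<le> d - 1" unfolding d_def by auto
  have "2 * (a / d) * a \<le> (a / d)\<^sup>2 * c" by (rule assms)
  also have "\<dots> \<le> (a / d)\<^sup>2 * (d - 1)" using d by (simp add: mult_left_mono)
  finally have "2 * a * a * d \<le> a * a * (d - 1)"
    using d by (simp add: power2_eq_square field_simps)
  hence "a * a * (d + 1) \<le> 0" by (simp add: algebra_simps)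
  thus ?thesis using d by (smt (verit) mult_nonneg_nonneg zero_le_square mult_eq_0_iff)
qed

lemma quadratic_form_add_scaled:
  fixes A :: "real^'n::finite^'n"
  assumes "transpose A = A"
  shows "(v + t *\<^sub>R w) \<bullet> (A *v (v + t *\<^sub>R w))
           = v \<bullet> (A *v v) + 2 * t * (v \<bullet> (A *v w)) + t\<^sup>2 * (w \<bullet> (A *v w))"
proof -
  have "w \<bullet> (A *v v) = v \<bullet> (A *v w)"
    using symmetric_matrix_inner_commute[OF assms, of w v] by (simp add: inner_commute)
  thus ?thesis
    by (simp add: matrix_vector_right_distrib inner_add_left inner_add_right
        matrix_vector_mult_scaleR algebra_simps power2_eq_square)
qed

text \<open>A maximiser of the Rayleigh quotient on the unit sphere of an invariant subspace is an
  eigenvector: the first variation in any direction orthogonal to it must vanish.\<close>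
lemma symmetric_invariant_subspace_has_eigenvector:
  fixes A :: "real^'n::finite^'n"
  assumes sym: "transpose A = A" and S: "subspace S" "S \<noteq> {0}"
    and inv: "\<And>x. x \<in> S \<Longrightarrow> A *v x \<in> S"
  obtains v where "v \<in> S" "norm v = 1" "A *v v = (v \<bullet> (A *v v)) *\<^sub>R v"
proof -
  define K where "K = S \<inter> sphere 0 1"
  have "compact K" unfolding K_def
    by (intro closed_Int_compact closed_subspace S compact_sphere)
  moreover obtain x where x: "x \<in> S" "x \<noteq> 0" using S subspace_0 by blast
  hence "(1 / norm x) *\<^sub>R x \<in> K" unfolding K_def using S by (simp add: subspace_scale)
  hence "K \<noteq> {}" by blast
  moreover have "continuous_on K (\<lambda>v. v \<bullet> (A *v v))"
    by (intro continuous_intros matrix_vector_mult_linear_continuous_on)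
  ultimately obtain v where v: "v \<in> K" and vmax: "\<And>u. u \<in> K \<Longrightarrow> u \<bullet> (A *v u) \<le> v \<bullet> (A *v v)"
    using continuous_attains_sup by metis
  define q where "q = v \<bullet> (A *v v)"
  have vS: "v \<in> S" and vv: "v \<bullet> v = 1" using v unfolding K_def by (auto simp: norm_eq_1)
  have first_variation: "v \<bullet> (A *v w) = 0" if wS: "w \<in> S" and wv: "v \<bullet> w = 0" for w
  proof (rule linear_le_quadratic_imp_zero[where c = "q * (w \<bullet> w) - w \<bullet> (A *v w)"])
    fix t :: real
    define p where "p = v + t *\<^sub>R w"
    have pS: "p \<in> S" unfolding p_def using vS wS S by (simp add: subspace_add subspace_scale)
    have pp: "p \<bullet> p = 1 + t\<^sup>2 * (w \<bullet> w)" unfolding p_def using vv wv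
      by (simp add: inner_add_left inner_add_right inner_commute power2_eq_square)
    hence np: "norm p > 0" by (metis add_pos_nonneg inner_ge_zero zero_le_mult_iff zero_le_power2
          zero_less_one inner_gt_zero_iff zero_less_norm_iff)
    have "(1 / norm p) *\<^sub>R p \<in> K" unfolding K_def using pS np S by (simp add: subspace_scale)
    hence "((1 / norm p) *\<^sub>R p) \<bullet> (A *v ((1 / norm p) *\<^sub>R p)) \<le> q"
      using vmax unfolding q_def by blast
    hence "(1 / norm p)\<^sup>2 * (p \<bullet> (A *v p)) \<le> q"
      by (simp add: matrix_vector_mult_scaleR power2_eq_square)
    hence "p \<bullet> (A *v p) \<le> q * (p \<bullet> p)"
      using np by (simp add: field_simps power2_norm_eq_inner[symmetric])
    hence "q + 2 * t * (v \<bullet> (A *v w)) + t\<^sup>2 * (w \<bullet> (A *v w)) \<le> q * (1 + t\<^sup>2 * (w \<bullet> w))"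
      unfolding pp using quadratic_form_add_scaled[OF sym, of v t w] unfolding p_def q_def by simp
    thus "2 * t * (v \<bullet> (A *v w)) \<le> t\<^sup>2 * (q * (w \<bullet> w) - w \<bullet> (A *v w))"
      by (simp add: algebra_simps)
  qed
  define w where "w = A *v v - q *\<^sub>R v"
  have "w \<in> S" unfolding w_def using vS S inv by (simp add: subspace_diff subspace_scale)
  moreover have wv: "v \<bullet> w = 0" unfolding w_def q_def using vv by (simp add: inner_diff_right)
  ultimately have "(A *v v) \<bullet> w = 0"
    using first_variation symmetric_matrix_inner_commute[OF sym] by simp
  hence "w \<bullet> w = 0" using wv unfolding w_def by (simp add: inner_diff_left inner_commute)
  hence "A *v v = q *\<^sub>R v" unfolding w_def by simp
  thus ?thesis using that vS v unfolding K_def q_def by auto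
qed

lemma symmetric_invariant_subspace_eigenbasis:
  fixes A :: "real^'n::finite^'n"
  assumes sym: "transpose A = A"
  shows "subspace S \<Longrightarrow> (\<And>x. x \<in> S \<Longrightarrow> A *v x \<in> S) \<Longrightarrow> \<exists>B. B \<subseteq> S \<and> pairwise orthogonal B \<and>
     (\<forall>b\<in>B. norm b = 1 \<and> A *v b = (b \<bullet> (A *v b)) *\<^sub>R b) \<and> span B = S"
proof (induction "dim S" arbitrary: S rule: less_induct)
  case less
  show ?case
  proof (cases "S = {0}")
    case True then show ?thesis by (intro exI[of _ "{}"]) auto
  next
    case False
    obtain v where vS: "v \<in> S" and vn: "norm v = 1" and Av: "A *v v = (v \<bullet> (A *v v)) *\<^sub>R v"
      using symmetric_invariant_subspace_has_eigenvector[OF sym less.prems(1) False less.prems(2)] .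
    have vv: "v \<bullet> v = 1" using vn by (simp add: norm_eq_1)
    define S' where "S' = {y \<in> S. v \<bullet> y = 0}"
    have subS': "subspace S'" unfolding S'_def using less.prems(1)
      by (auto simp: subspace_def inner_add_right)
    have invS': "A *v y \<in> S'" if "y \<in> S'" for y
    proof -
      have "v \<bullet> (A *v y) = (A *v v) \<bullet> y" using symmetric_matrix_inner_commute[OF sym] by simp
      also have "\<dots> = (v \<bullet> (A *v v)) * (v \<bullet> y)" by (subst Av) simp
      finally show ?thesis using that less.prems(2) unfolding S'_def by simp
    qed
    have "S' \<subset> S" unfolding S'_def using vS vv by force
    hence "dim S' < dim S" using dim_psubset span_eq_iff subS' less.prems(1) by metis
    then obtain B' where B': "B' \<subseteq> S'" "pairwise orthogonal B'"
      "\<forall>b\<in>B'. norm b = 1 \<and> A *v b = (b \<bullet> (A *v b)) *\<^sub>R b" "span B' = S'"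
      using less.hyps[OF _ subS' invS'] by blast
    show ?thesis
    proof (intro exI[of _ "insert v B'"] conjI)
      show sub: "insert v B' \<subseteq> S" using B'(1) vS unfolding S'_def by auto
      have "v \<notin> B'" using B'(1) vv unfolding S'_def by auto
      thus "pairwise orthogonal (insert v B')" using B'(1,2) unfolding S'_def
        by (auto simp: pairwise_insert orthogonal_def inner_commute)
      show "\<forall>b\<in>insert v B'. norm b = 1 \<and> A *v b = (b \<bullet> (A *v b)) *\<^sub>R b"
        using B'(3) vn Av by auto
      have "y \<in> span (insert v B')" if "y \<in> S" for y
      proof -
        have "y - (v \<bullet> y) *\<^sub>R v \<in> S'" unfolding S'_def using that vS vv less.prems(1)
          by (simp add: subspace_diff subspace_scale inner_diff_right)
        thus ?thesis using B'(4) span_breakdown_eq by blast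
      qed
      moreover have "span (insert v B') \<subseteq> S" using sub less.prems(1) by (rule span_minimal)
      ultimately show "span (insert v B') = S" by blast
    qed
  qed
qed

locale orthonormal_eigenbasis =
  fixes A :: "real^'n::finite^'n" and B :: "(real^'n) set"
  assumes symmetric: "transpose A = A"
    and orthogonal: "pairwise orthogonal B"
    and unit: "\<And>b. b \<in> B \<Longrightarrow> norm b = 1"
    and eigenvector: "\<And>b. b \<in> B \<Longrightarrow> A *v b = (b \<bullet> (A *v b)) *\<^sub>R b"
    and spanning: "span B = UNIV"
    and finite: "finite B"
    and card: "card B = CARD('n)"

lemma symmetric_orthonormal_eigenbasis:
  fixes A :: "real^'n::finite^'n"
  assumes sym: "transpose A = A"
  obtains B where "orthonormal_eigenbasis A B"
proof -
  obtain B where B: "pairwise orthogonal B" "\<forall>b\<in>B. norm b = 1 \<and> A *v b = (b \<bullet> (A *v b)) *\<^sub>R b"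
    "span B = UNIV"
    using symmetric_invariant_subspace_eigenbasis[OF sym, of UNIV] by auto
  have ind: "independent B" using B(1,2) by (intro pairwise_orthogonal_independent) auto
  hence "finite B" using independent_imp_finite by blast
  have "card B = dim (UNIV :: (real^'n) set)" using ind B(3)
    by (metis dim_span dim_eq_card_independent)
  hence "card B = CARD('n)" by simp
  with B sym \<open>finite B\<close> show ?thesis by (intro that orthonormal_eigenbasis.intro) auto
qed

context orthonormal_eigenbasis
begin

definition eigval :: "real^'n \<Rightarrow> real" where
  "eigval b = b \<bullet> (A *v b)"

lemma eigenvector_eigval: "b \<in> B \<Longrightarrow> A *v b = eigval b *\<^sub>R b"
  using eigenvector unfolding eigval_def by blast

lemma inner_basis_self: "b \<in> B \<Longrightarrow> b \<bullet> b = 1"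
  using unit by (simp add: norm_eq_1)

lemma inner_basis_distinct: "b \<in> B \<Longrightarrow> b' \<in> B \<Longrightarrow> b \<noteq> b' \<Longrightarrow> b \<bullet> b' = 0"
  using orthogonal unfolding pairwise_def orthogonal_def by blast

lemma independent_basis: "independent B"
  using orthogonal unit by (intro pairwise_orthogonal_independent) (auto, fastforce)

lemma inner_sum_basis:
  assumes "b' \<in> B"
  shows "(\<Sum>b\<in>B. c b *\<^sub>R b) \<bullet> b' = c b'"
proof -
  have "(\<Sum>b\<in>B. c b *\<^sub>R b) \<bullet> b' = (\<Sum>b\<in>B. if b = b' then c b' else 0)"
    unfolding inner_sum_left
    by (rule sum.cong) (use assms inner_basis_self inner_basis_distinct in auto)
  thus ?thesis using assms finite by simp
qed

lemma basis_expansion: "(\<Sum>b\<in>B. (x \<bullet> b) *\<^sub>R b) = x"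
  by (rule orthonormal_basis_expand) (use orthogonal unit spanning finite in auto)

lemma inner_self_sum_basis:
  "(\<Sum>b\<in>B. c b *\<^sub>R b) \<bullet> (\<Sum>b\<in>B. c b *\<^sub>R b) = (\<Sum>b\<in>B. (c b)\<^sup>2)"
proof -
  have "(\<Sum>b\<in>B. c b *\<^sub>R b) \<bullet> (\<Sum>b\<in>B. c b *\<^sub>R b) = (\<Sum>b'\<in>B. c b' * ((\<Sum>b\<in>B. c b *\<^sub>R b) \<bullet> b'))"
    by (simp add: inner_sum_right)
  also have "\<dots> = (\<Sum>b\<in>B. (c b)\<^sup>2)" by (rule sum.cong) (auto simp: inner_sum_basis power2_eq_square)
  finally show ?thesis .
qed

lemma inner_self_eq_sum: "x \<bullet> x = (\<Sum>b\<in>B. (x \<bullet> b)\<^sup>2)"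
  using inner_self_sum_basis[of "\<lambda>b. x \<bullet> b"] basis_expansion by simp

lemma matrix_vector_expansion: "A *v x = (\<Sum>b\<in>B. (eigval b * (x \<bullet> b)) *\<^sub>R b)"
proof -
  have "A *v x = (\<Sum>b\<in>B. (x \<bullet> b) *\<^sub>R (A *v b))"
    by (subst (1) basis_expansion[symmetric]) (simp add: vec.sum matrix_vector_mult_scaleR)
  thus ?thesis by (auto simp: eigenvector_eigval mult.commute intro: sum.cong)
qed

lemma quadratic_form_eq_sum: "x \<bullet> (A *v x) = (\<Sum>b\<in>B. eigval b * (x \<bullet> b)\<^sup>2)"
  unfolding matrix_vector_expansion inner_sum_right
  by (simp add: power2_eq_square mult.assoc inner_commute)

lemma residual_inner_self_eq_sum:
  "(A *v x - l *\<^sub>R x) \<bullet> (A *v x - l *\<^sub>R x) = (\<Sum>b\<in>B. (eigval b - l)\<^sup>2 * (x \<bullet> b)\<^sup>2)"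
proof -
  have "l *\<^sub>R x = (\<Sum>b\<in>B. (l * (x \<bullet> b)) *\<^sub>R b)"
    using basis_expansion[of x] by (metis (no_types, lifting) scaleR_right.sum scaleR_scaleR sum.cong)
  hence "A *v x - l *\<^sub>R x = (\<Sum>b\<in>B. ((eigval b - l) * (x \<bullet> b)) *\<^sub>R b)"
    unfolding matrix_vector_expansion
    by (simp add: sum_subtractf[symmetric] algebra_simps scaleR_diff_left)
  thus ?thesis
    using inner_self_sum_basis[of "\<lambda>b. (eigval b - l) * (x \<bullet> b)"] by (simp add: power_mult_distrib)
qed

lemma eigenspace_eq_span: "eigenspace A \<mu> = span {b\<in>B. eigval b = \<mu>}"
proof
  show "eigenspace A \<mu> \<subseteq> span {b\<in>B. eigval b = \<mu>}"
  proof
    fix x assume "x \<in> eigenspace A \<mu>"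
    hence "(\<Sum>b\<in>B. (eigval b - \<mu>)\<^sup>2 * (x \<bullet> b)\<^sup>2) = 0"
      using residual_inner_self_eq_sum[of x \<mu>] unfolding eigenspace_def by simp
    hence "\<forall>b\<in>B. (eigval b - \<mu>)\<^sup>2 * (x \<bullet> b)\<^sup>2 = 0" by (simp add: sum_nonneg_eq_0_iff[OF finite])
    hence "\<forall>b\<in>B. eigval b \<noteq> \<mu> \<longrightarrow> (x \<bullet> b) *\<^sub>R b = 0" by auto
    hence "(\<Sum>b\<in>B. (x \<bullet> b) *\<^sub>R b) = (\<Sum>b\<in>{b\<in>B. eigval b = \<mu>}. (x \<bullet> b) *\<^sub>R b)"
      by (intro sum.mono_neutral_right finite) auto
    hence "x = (\<Sum>b\<in>{b\<in>B. eigval b = \<mu>}. (x \<bullet> b) *\<^sub>R b)" by (simp add: basis_expansion)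
    also have "\<dots> \<in> span {b\<in>B. eigval b = \<mu>}" by (intro span_sum span_scale span_base) auto
    finally show "x \<in> span {b\<in>B. eigval b = \<mu>}" .
  qed
  have "subspace (eigenspace A \<mu>)" unfolding eigenspace_def subspace_def
    by (simp add: matrix_vector_right_distrib matrix_vector_mult_scaleR scaleR_add_right)
  moreover have "{b\<in>B. eigval b = \<mu>} \<subseteq> eigenspace A \<mu>"
    unfolding eigenspace_def using eigenvector_eigval by auto
  ultimately show "span {b\<in>B. eigval b = \<mu>} \<subseteq> eigenspace A \<mu>" by (simp add: span_minimal)
qed

lemma dim_span_subset: "T \<subseteq> B \<Longrightarrow> dim (span T) = card T"
  by (metis dim_span dim_eq_card_independent independent_basis independent_mono)

lemma dim_eigenspace: "dim (eigenspace A \<mu>) = card {b\<in>B. eigval b = \<mu>}"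
  unfolding eigenspace_eq_span by (rule dim_span_subset) auto

lemma eigenvalues_eq: "{\<mu>. \<exists>v. v \<noteq> 0 \<and> A *v v = \<mu> *\<^sub>R v} = eigval ` B"
proof
  show "{\<mu>. \<exists>v. v \<noteq> 0 \<and> A *v v = \<mu> *\<^sub>R v} \<subseteq> eigval ` B"
  proof
    fix \<mu> assume "\<mu> \<in> {\<mu>. \<exists>v. v \<noteq> 0 \<and> A *v v = \<mu> *\<^sub>R v}"
    then obtain v where "v \<noteq> 0" "v \<in> eigenspace A \<mu>" unfolding eigenspace_def by auto
    hence "{b\<in>B. eigval b = \<mu>} \<noteq> {}" unfolding eigenspace_eq_span by (metis span_empty singletonD)
    thus "\<mu> \<in> eigval ` B" by auto
  qed
  show "eigval ` B \<subseteq> {\<mu>. \<exists>v. v \<noteq> 0 \<and> A *v v = \<mu> *\<^sub>R v}"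
  proof
    fix \<mu> assume "\<mu> \<in> eigval ` B"
    then obtain b where "b \<in> B" "\<mu> = eigval b" by blast
    moreover have "b \<noteq> 0" using unit[OF \<open>b \<in> B\<close>] by auto
    ultimately show "\<mu> \<in> {\<mu>. \<exists>v. v \<noteq> 0 \<and> A *v v = \<mu> *\<^sub>R v}" using eigenvector_eigval by blast
  qed
qed

lemma eig_mset_eq: "eig_mset A = image_mset eigval (mset_set B)"
proof (rule multiset_eqI)
  fix x
  have "count (eig_mset A) x = (\<Sum>\<mu>\<in>eigval ` B. if \<mu> = x then card {b\<in>B. eigval b = x} else 0)"
    unfolding eig_mset_def eigenvalues_eq dim_eigenspace count_sum by (rule sum.cong) auto
  also have "\<dots> = card {b\<in>B. eigval b = x}" using finite by (auto simp: sum.delta)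
  also have "\<dots> = count (image_mset eigval (mset_set B)) x"
    using finite by (simp add: count_image_mset Int_def conj_commute vimage_def)
  finally show "count (eig_mset A) x = count (image_mset eigval (mset_set B)) x" .
qed

lemma size_filter_eig_mset: "size (filter_mset P (eig_mset A)) = card {b\<in>B. P (eigval b)}"
  unfolding eig_mset_eq using finite
  by (simp add: filter_mset_image_mset filter_mset_mset_set)

lemma count_eig_mset: "count (eig_mset A) \<mu> = card {b\<in>B. eigval b = \<mu>}"
  using size_filter_eig_mset[of "\<lambda>x. x = \<mu>"]
  by (metis (mono_tags) filter_eq_replicate_mset size_replicate_mset)

lemma length_sorted_eigenvalues: "length (sorted_list_of_multiset (eig_mset A)) = CARD('n)"
proof -
  have "size (eig_mset A) = CARD('n)" unfolding eig_mset_eq using finite card by simp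
  thus ?thesis by (metis mset_sorted_list_of_multiset size_mset)
qed

lemma lam_in_eigenvalues:
  assumes "1 \<le> j" "j \<le> CARD('n)"
  shows "lam A j \<in> eigval ` B"
proof -
  have "j - 1 < length (sorted_list_of_multiset (eig_mset A))"
    using assms length_sorted_eigenvalues by simp
  hence "lam A j \<in> set (sorted_list_of_multiset (eig_mset A))" unfolding lam_def by (rule nth_mem)
  hence "lam A j \<in># eig_mset A" by simp
  thus ?thesis unfolding eig_mset_eq using finite by auto
qed

end

section \<open>Eigenvalue counting and Weyl's inequality\<close>

lemma sorted_nth_less_iff_length_filter:
  fixes xs :: "'a::linorder list"
  assumes "sorted xs" "i < length xs"
  shows "xs ! i < t \<longleftrightarrow> i < length (filter (\<lambda>x. x < t) xs)"
  using assms
proof (induction xs arbitrary: i)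
  case (Cons x xs)
  show ?case
  proof (cases "x < t")
    case True
    thus ?thesis using Cons by (cases i) auto
  next
    case False
    hence "\<forall>y\<in>set (x # xs). \<not> y < t" using Cons.prems(1) by auto
    thus ?thesis using Cons.prems(2) nth_mem by (metis filter_False length_0_conv not_less0)
  qed
qed simp

context orthonormal_eigenbasis
begin

definition count_below :: "real \<Rightarrow> nat" where
  "count_below t = card {b\<in>B. eigval b < t}"

lemma lam_less_iff_count_below:
  assumes "1 \<le> j" "j \<le> CARD('n)"
  shows "lam A j < t \<longleftrightarrow> j \<le> count_below t"
proof -
  define L where "L = sorted_list_of_multiset (eig_mset A)"
  have "length (filter (\<lambda>x. x < t) L) = size (filter_mset (\<lambda>x. x < t) (eig_mset A))"
    unfolding L_def by (metis mset_filter mset_sorted_list_of_multiset size_mset)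
  hence "length (filter (\<lambda>x. x < t) L) = count_below t"
    unfolding count_below_def size_filter_eig_mset .
  moreover have "lam A j < t \<longleftrightarrow> j - 1 < length (filter (\<lambda>x. x < t) L)"
    unfolding lam_def L_def[symmetric]
    by (rule sorted_nth_less_iff_length_filter) (use assms length_sorted_eigenvalues in \<open>auto simp: L_def\<close>)
  ultimately show ?thesis using assms(1) by auto
qed

lemma inner_eq_0_outside:
  assumes "T \<subseteq> B" "v \<in> span T" "b \<in> B - T"
  shows "v \<bullet> b = 0"
proof -
  have "T \<subseteq> {v. v \<bullet> b = 0}" using assms(1,3) inner_basis_distinct by auto
  hence "span T \<subseteq> {v. v \<bullet> b = 0}"
    by (intro span_minimal) (auto simp: subspace_def inner_add_left)
  thus ?thesis using assms(2) by auto
qed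

lemma quadratic_form_less_on_span_below:
  assumes "v \<in> span {b\<in>B. eigval b < t}" "v \<noteq> 0"
  shows "v \<bullet> (A *v v) < t * (v \<bullet> v)"
proof -
  have outside: "v \<bullet> b = 0" if "b \<in> B" "\<not> eigval b < t" for b
    using inner_eq_0_outside[of "{b\<in>B. eigval b < t}" v b] assms(1) that by auto
  have "0 < v \<bullet> v" using assms(2) by simp
  hence "0 < (\<Sum>b\<in>B. (v \<bullet> b)\<^sup>2)" by (simp add: inner_self_eq_sum[symmetric])
  then obtain b0 where b0: "b0 \<in> B" "(v \<bullet> b0)\<^sup>2 \<noteq> 0"
    by (metis (no_types, lifting) sum.neutral less_irrefl)
  have "v \<bullet> (A *v v) = (\<Sum>b\<in>B. eigval b * (v \<bullet> b)\<^sup>2)" by (rule quadratic_form_eq_sum)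
  also have "\<dots> < (\<Sum>b\<in>B. t * (v \<bullet> b)\<^sup>2)"
  proof (rule sum_strict_mono_ex1[OF finite])
    show "\<forall>b\<in>B. eigval b * (v \<bullet> b)\<^sup>2 \<le> t * (v \<bullet> b)\<^sup>2"
      using outside by (force intro: mult_right_mono)
    have "eigval b0 < t" using outside b0 by fastforce
    thus "\<exists>b\<in>B. eigval b * (v \<bullet> b)\<^sup>2 < t * (v \<bullet> b)\<^sup>2"
      using b0 by (intro bexI[of _ b0]) (simp_all add: mult_strict_right_mono)
  qed
  also have "\<dots> = t * (v \<bullet> v)" by (simp add: inner_self_eq_sum sum_distrib_left)
  finally show ?thesis .
qed

lemma quadratic_form_ge_on_span_above:
  assumes "v \<in> span {b\<in>B. s \<le> eigval b}"
  shows "s * (v \<bullet> v) \<le> v \<bullet> (A *v v)"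
proof -
  have outside: "v \<bullet> b = 0" if "b \<in> B" "\<not> s \<le> eigval b" for b
    using inner_eq_0_outside[of "{b\<in>B. s \<le> eigval b}" v b] assms that by auto
  have "s * (v \<bullet> v) = (\<Sum>b\<in>B. s * (v \<bullet> b)\<^sup>2)" by (simp add: inner_self_eq_sum sum_distrib_left)
  also have "\<dots> \<le> (\<Sum>b\<in>B. eigval b * (v \<bullet> b)\<^sup>2)"
    using outside by (force intro: sum_mono mult_right_mono)
  also have "\<dots> = v \<bullet> (A *v v)" by (rule quadratic_form_eq_sum[symmetric])
  finally show ?thesis .
qed

end

text \<open>Courant--Fischer in counting form: the span of the eigenvectors of A below t and that of
  the eigenvectors of C at or above t + \<eta> meet only in 0, so their dimensions add up to at
  most n.\<close>
lemma count_below_le_perturb: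
  fixes A C :: "real^'n::finite^'n"
  assumes EA: "orthonormal_eigenbasis A BA" and EC: "orthonormal_eigenbasis C BC"
    and le: "\<And>v. v \<bullet> (C *v v) \<le> v \<bullet> (A *v v) + \<eta> * (v \<bullet> v)"
  shows "orthonormal_eigenbasis.count_below A BA t \<le> orthonormal_eigenbasis.count_below C BC (t + \<eta>)"
proof -
  interpret a: orthonormal_eigenbasis A BA by (rule EA)
  interpret c: orthonormal_eigenbasis C BC by (rule EC)
  define V where "V = span {b\<in>BA. a.eigval b < t}"
  define W where "W = span {b\<in>BC. t + \<eta> \<le> c.eigval b}"
  have "card {b\<in>BC. t + \<eta> \<le> c.eigval b} + c.count_below (t + \<eta>) = CARD('n)"
    unfolding c.count_below_def c.card[symmetric]
    by (subst card_Un_disjoint[symmetric]) (use c.finite in \<open>auto intro: arg_cong[where f = card]\<close>)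
  moreover have "V \<inter> W = {0}"
  proof (rule ccontr)
    assume "V \<inter> W \<noteq> {0}"
    moreover have "0 \<in> V \<inter> W" unfolding V_def W_def by (simp add: span_zero)
    ultimately obtain v where v: "v \<in> V" "v \<in> W" "v \<noteq> 0" by blast
    have "v \<bullet> (A *v v) < t * (v \<bullet> v)"
      using a.quadratic_form_less_on_span_below v unfolding V_def by blast
    moreover have "(t + \<eta>) * (v \<bullet> v) \<le> v \<bullet> (C *v v)"
      using c.quadratic_form_ge_on_span_above v unfolding W_def by blast
    ultimately show False using le[of v] by (simp add: algebra_simps)
  qed
  hence "dim V + dim W \<le> CARD('n)"
    using dim_sums_Int[of V W] dim_subset_UNIV_cart[of "{x + y |x y. x \<in> V \<and> y \<in> W}"]
    unfolding V_def W_def by simp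
  moreover have "dim V = a.count_below t"
    unfolding V_def a.count_below_def by (rule a.dim_span_subset) auto
  moreover have "dim W = card {b\<in>BC. t + \<eta> \<le> c.eigval b}"
    unfolding W_def by (rule c.dim_span_subset) auto
  ultimately show ?thesis by linarith
qed

lemma lam_le_perturb:
  fixes A C :: "real^'n::finite^'n"
  assumes EA: "orthonormal_eigenbasis A BA" and EC: "orthonormal_eigenbasis C BC"
    and le: "\<And>v. v \<bullet> (C *v v) \<le> v \<bullet> (A *v v) + \<eta> * (v \<bullet> v)"
    and j: "1 \<le> j" "j \<le> CARD('n)"
  shows "lam C j \<le> lam A j + \<eta>"
proof (rule ccontr)
  interpret a: orthonormal_eigenbasis A BA by (rule EA)
  interpret c: orthonormal_eigenbasis C BC by (rule EC)
  assume "\<not> lam C j \<le> lam A j + \<eta>"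
  define t where "t = (lam C j - \<eta> + lam A j) / 2"
  have "lam A j < t" using \<open>\<not> _\<close> unfolding t_def by simp
  hence "j \<le> c.count_below (t + \<eta>)"
    using count_below_le_perturb[OF EA EC le, of t] a.lam_less_iff_count_below[OF j] by simp
  hence "lam C j < t + \<eta>" using c.lam_less_iff_count_below[OF j] by simp
  thus False using \<open>\<not> _\<close> unfolding t_def by (simp add: field_simps)
qed

lemma quadratic_form_le_perturb:
  fixes A C :: "real^'n::finite^'n"
  assumes "\<And>v. norm ((C - A) *v v) \<le> \<eta> * norm v"
  shows "v \<bullet> (C *v v) \<le> v \<bullet> (A *v v) + \<eta> * (v \<bullet> v)"
proof -
  have "v \<bullet> ((C - A) *v v) \<le> norm v * norm ((C - A) *v v)" by (rule norm_cauchy_schwarz)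
  also have "\<dots> \<le> norm v * (\<eta> * norm v)" by (simp add: assms mult_left_mono)
  also have "\<dots> = \<eta> * (v \<bullet> v)"
    by (simp add: power2_norm_eq_inner[symmetric] power2_eq_square)
  finally show ?thesis by (simp add: matrix_vector_mult_diff_rdistrib inner_diff_right)
qed

lemma weyl_inequality_lam:
  fixes A C :: "real^'n::finite^'n"
  assumes "transpose A = A" "transpose C = C"
    and pert: "\<And>v. norm ((C - A) *v v) \<le> \<eta> * norm v"
    and j: "1 \<le> j" "j \<le> CARD('n)"
  shows "\<bar>lam C j - lam A j\<bar> \<le> \<eta>"
proof -
  obtain BA BC where EA: "orthonormal_eigenbasis A BA" and EC: "orthonormal_eigenbasis C BC"
    using symmetric_orthonormal_eigenbasis assms(1,2) by metis
  have "norm ((A - C) *v v) \<le> \<eta> * norm v" for v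
    using pert[of v] by (simp add: matrix_vector_mult_diff_rdistrib norm_minus_commute)
  hence "lam A j \<le> lam C j + \<eta>"
    by (intro lam_le_perturb[OF EC EA _ j] quadratic_form_le_perturb)
  moreover have "lam C j \<le> lam A j + \<eta>"
    by (intro lam_le_perturb[OF EA EC _ j] quadratic_form_le_perturb pert)
  ultimately show ?thesis by linarith
qed

section \<open>Perturbation of simple eigenvectors\<close>

lemma unit_vectors_sign_dist:
  fixes x b :: "'a::real_inner"
  assumes "norm x = 1" "norm b = 1"
  obtains \<sigma> :: real where "\<sigma> = 1 \<or> \<sigma> = -1" "(norm (x - \<sigma> *\<^sub>R b))\<^sup>2 \<le> 2 * (1 - (x \<bullet> b)\<^sup>2)"
proof -
  define c where "c = x \<bullet> b"
  define \<sigma> :: real where "\<sigma> = (if c \<ge> 0 then 1 else -1)"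
  have "\<bar>c\<bar> \<le> 1" unfolding c_def using Cauchy_Schwarz_ineq2[of x b] assms by simp
  hence "c\<^sup>2 \<le> \<bar>c\<bar>" by (metis abs_ge_zero mult_left_le power2_abs power2_eq_square)
  moreover have "x \<bullet> x = 1" "b \<bullet> b = 1" using assms by (simp_all add: norm_eq_1)
  hence "(norm (x - \<sigma> *\<^sub>R b))\<^sup>2 = 2 - 2 * \<bar>c\<bar>"
    unfolding power2_norm_eq_inner c_def \<sigma>_def
    by (simp add: inner_diff_left inner_diff_right inner_commute[of b x])
  ultimately show ?thesis by (intro that[of \<sigma>]) (auto simp: \<sigma>_def c_def)
qed

context orthonormal_eigenbasis
begin

lemma davis_kahan_sin_theta:
  assumes b0: "b0 \<in> B" and gap: "0 \<le> d" "\<And>b. b \<in> B - {b0} \<Longrightarrow> d \<le> \<bar>eigval b - l\<bar>"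
    and x: "norm x = 1" and residual: "norm (A *v x - l *\<^sub>R x) \<le> \<eta>"
  obtains \<sigma> :: real where "\<sigma> = 1 \<or> \<sigma> = -1" "d * norm (x - \<sigma> *\<^sub>R b0) \<le> 2 * \<eta>"
proof -
  define c where "c = x \<bullet> b0"
  have "d\<^sup>2 \<le> (eigval b - l)\<^sup>2" if "b \<in> B - {b0}" for b
    using gap(2)[OF that] gap(1) by (metis abs_le_square_iff abs_of_nonneg)
  hence "d\<^sup>2 * (\<Sum>b\<in>B - {b0}. (x \<bullet> b)\<^sup>2) \<le> (\<Sum>b\<in>B - {b0}. (eigval b - l)\<^sup>2 * (x \<bullet> b)\<^sup>2)"
    unfolding sum_distrib_left by (intro sum_mono mult_right_mono) auto
  also have "\<dots> \<le> (\<Sum>b\<in>B. (eigval b - l)\<^sup>2 * (x \<bullet> b)\<^sup>2)" by (rule sum_mono2) (use finite in auto)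
  also have "\<dots> \<le> \<eta>\<^sup>2"
    unfolding residual_inner_self_eq_sum[symmetric] power2_norm_eq_inner[symmetric]
    using residual by (simp add: power_mono)
  finally have "d\<^sup>2 * (\<Sum>b\<in>B - {b0}. (x \<bullet> b)\<^sup>2) \<le> \<eta>\<^sup>2" .
  moreover have "1 = c\<^sup>2 + (\<Sum>b\<in>B - {b0}. (x \<bullet> b)\<^sup>2)"
    using inner_self_eq_sum[of x] x b0 finite unfolding c_def by (simp add: sum.remove norm_eq_1)
  hence "(\<Sum>b\<in>B - {b0}. (x \<bullet> b)\<^sup>2) = 1 - c\<^sup>2" by linarith
  ultimately have dc: "d\<^sup>2 * (1 - c\<^sup>2) \<le> \<eta>\<^sup>2" by simp
  obtain \<sigma> :: real where \<sigma>: "\<sigma> = 1 \<or> \<sigma> = -1" "(norm (x - \<sigma> *\<^sub>R b0))\<^sup>2 \<le> 2 * (1 - c\<^sup>2)"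
    using unit_vectors_sign_dist[OF x unit[OF b0]] unfolding c_def by blast
  have "(d * norm (x - \<sigma> *\<^sub>R b0))\<^sup>2 \<le> d\<^sup>2 * (2 * (1 - c\<^sup>2))"
    unfolding power_mult_distrib by (rule mult_left_mono[OF \<sigma>(2)]) simp
  also have "\<dots> = 2 * (d\<^sup>2 * (1 - c\<^sup>2))" by (simp add: algebra_simps)
  also have "\<dots> \<le> 2 * \<eta>\<^sup>2" using dc by linarith
  also have "\<dots> \<le> (2 * \<eta>)\<^sup>2" by (simp add: power_mult_distrib)
  finally have "d * norm (x - \<sigma> *\<^sub>R b0) \<le> 2 * \<eta>"
    by (rule power2_le_imp_le) (use residual norm_ge_zero in \<open>smt (verit)\<close>)
  thus ?thesis using \<sigma>(1) that by blast
qed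

lemma simple_eigenvalue_gap:
  assumes "count (eig_mset A) \<mu> = 1"
  obtains b0 g where "b0 \<in> B" "eigval b0 = \<mu>" "g > 0" "\<And>b. b \<in> B - {b0} \<Longrightarrow> g \<le> \<bar>eigval b - \<mu>\<bar>"
proof -
  obtain b0 where b0: "{b\<in>B. eigval b = \<mu>} = {b0}"
    using assms count_eig_mset card_1_singletonE by metis
  define g where "g = Min (insert 1 ((\<lambda>b. \<bar>eigval b - \<mu>\<bar>) ` (B - {b0})))"
  have "finite (insert 1 ((\<lambda>b. \<bar>eigval b - \<mu>\<bar>) ` (B - {b0})))" using finite by simp
  moreover have "\<And>b. b \<in> B - {b0} \<Longrightarrow> eigval b \<noteq> \<mu>" using b0 by blast
  ultimately have "g > 0" "\<And>b. b \<in> B - {b0} \<Longrightarrow> g \<le> \<bar>eigval b - \<mu>\<bar>"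
    unfolding g_def by (auto simp: Min_gr_iff intro!: Min_le)
  thus ?thesis using b0 that by blast
qed

end

definition unit_eigvec :: "real^'n::finite^'n \<Rightarrow> nat \<Rightarrow> real^'n" where
  "unit_eigvec A j = (SOME x. norm x = 1 \<and> A *v x = lam A j *\<^sub>R x)"

lemma unit_eigvec:
  fixes A :: "real^'n::finite^'n"
  assumes "transpose A = A" "1 \<le> j" "j \<le> CARD('n)"
  shows "norm (unit_eigvec A j) = 1" "A *v unit_eigvec A j = lam A j *\<^sub>R unit_eigvec A j"
proof -
  obtain B where "orthonormal_eigenbasis A B" using symmetric_orthonormal_eigenbasis assms(1) .
  then interpret orthonormal_eigenbasis A B .
  obtain b where "b \<in> B" "lam A j = eigval b" using lam_in_eigenvalues[OF assms(2,3)] by blast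
  hence "\<exists>x. norm x = 1 \<and> A *v x = lam A j *\<^sub>R x" using unit eigenvector_eigval by metis
  from someI_ex[OF this] show "norm (unit_eigvec A j) = 1" "A *v unit_eigvec A j = lam A j *\<^sub>R unit_eigvec A j"
    unfolding unit_eigvec_def by auto
qed

lemma unit_eigvec_perturb:
  fixes A :: "real^'n::finite^'n"
  assumes symA: "transpose A = A" and j: "1 \<le> j" "j \<le> CARD('n)"
    and simple: "count (eig_mset A) (lam A j) = 1"
  obtains g where "g > 0"
    "\<And>C \<eta>. transpose C = C \<Longrightarrow> (\<And>v. norm ((C - A) *v v) \<le> \<eta> * norm v) \<Longrightarrow> \<eta> \<le> g / 2 \<Longrightarrow>
       \<exists>s::real. (s = 1 \<or> s = -1) \<and> norm (unit_eigvec C j - s *\<^sub>R unit_eigvec A j) \<le> (4 / g) * \<eta>"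
proof -
  obtain B where "orthonormal_eigenbasis A B" using symmetric_orthonormal_eigenbasis symA .
  then interpret orthonormal_eigenbasis A B .
  obtain b0 g where b0: "b0 \<in> B" and g: "g > 0" "\<And>b. b \<in> B - {b0} \<Longrightarrow> g \<le> \<bar>eigval b - lam A j\<bar>"
    using simple_eigenvalue_gap[OF simple] by blast
  obtain s0 :: real where s0: "s0 = 1 \<or> s0 = -1" "g * norm (unit_eigvec A j - s0 *\<^sub>R b0) \<le> 2 * 0"
    by (rule davis_kahan_sin_theta[OF b0 _ g(2), of _ 0])
      (use g unit_eigvec[OF symA j] in auto)
  hence b0_eq: "b0 = s0 *\<^sub>R unit_eigvec A j" using g(1) by (auto simp: mult_le_0_iff)
  show ?thesis
  proof (intro that[OF g(1)])
    fix C :: "real^'n^'n" and \<eta> :: real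
    assume symC: "transpose C = C" and pert: "\<And>v. norm ((C - A) *v v) \<le> \<eta> * norm v"
      and small: "\<eta> \<le> g / 2"
    define x where "x = unit_eigvec C j"
    have x: "norm x = 1" "C *v x = lam C j *\<^sub>R x" using unit_eigvec[OF symC j] unfolding x_def by auto
    have "\<bar>lam C j - lam A j\<bar> \<le> \<eta>" by (rule weyl_inequality_lam[OF symA symC pert j])
    hence "g / 2 \<le> \<bar>eigval b - lam C j\<bar>" if "b \<in> B - {b0}" for b using g(2)[OF that] small by linarith
    moreover have "norm (A *v x - lam C j *\<^sub>R x) \<le> \<eta>"
      using pert[of x] x by (simp add: matrix_vector_mult_diff_rdistrib norm_minus_commute)
    ultimately obtain \<sigma> :: real where \<sigma>: "\<sigma> = 1 \<or> \<sigma> = -1" "g / 2 * norm (x - \<sigma> *\<^sub>R b0) \<le> 2 * \<eta>"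
      using davis_kahan_sin_theta[OF b0 _ _ x(1)] g(1) by (metis less_eq_real_def half_gt_zero)
    hence "norm (x - (\<sigma> * s0) *\<^sub>R unit_eigvec A j) \<le> (4 / g) * \<eta>"
      using g(1) b0_eq by (simp add: field_simps)
    moreover have "\<sigma> * s0 = 1 \<or> \<sigma> * s0 = -1" using \<sigma>(1) s0(1) by auto
    ultimately show "\<exists>s::real. (s = 1 \<or> s = -1) \<and> norm (unit_eigvec C j - s *\<^sub>R unit_eigvec A j) \<le> (4 / g) * \<eta>"
      unfolding x_def by blast
  qed
qed

section \<open>Frobenius norm and outer products\<close>

lemma frob_norm_eq_norm: "frob_norm X = norm X"
proof -
  have "frob_inner X X = (\<Sum>i\<in>UNIV. \<Sum>k\<in>UNIV. X$k$i * X$k$i)"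
    unfolding frob_inner_def trace_def matrix_matrix_mult_def transpose_def by simp
  also have "\<dots> = X \<bullet> X" by (subst sum.swap) (simp add: inner_vec_def)
  finally show ?thesis unfolding frob_norm_def by (simp add: norm_eq_sqrt_inner)
qed

lemma norm_sq_eq_sum_components:
  fixes x :: "'a::real_inner^'n::finite"
  shows "(norm x)\<^sup>2 = (\<Sum>i\<in>UNIV. (norm (x$i))\<^sup>2)"
  by (simp add: power2_norm_eq_inner inner_vec_def)

lemma norm_matrix_vector_le:
  fixes M :: "real^'n::finite^'m::finite"
  shows "norm (M *v v) \<le> norm M * norm v"
proof -
  have "(norm (M *v v))\<^sup>2 = (\<Sum>i\<in>UNIV. (M$i \<bullet> v)\<^sup>2)"
    by (simp add: norm_sq_eq_sum_components matrix_vector_mul_component)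
  also have "\<dots> \<le> (\<Sum>i\<in>UNIV. (norm (M$i))\<^sup>2 * (norm v)\<^sup>2)"
  proof (rule sum_mono)
    fix i
    have "\<bar>M$i \<bullet> v\<bar>\<^sup>2 \<le> (norm (M$i) * norm v)\<^sup>2"
      by (rule power_mono[OF Cauchy_Schwarz_ineq2]) simp
    thus "(M$i \<bullet> v)\<^sup>2 \<le> (norm (M$i))\<^sup>2 * (norm v)\<^sup>2" by (simp add: power_mult_distrib)
  qed
  also have "\<dots> = (norm M * norm v)\<^sup>2"
    by (simp add: norm_sq_eq_sum_components[of M] power_mult_distrib sum_distrib_right)
  finally show ?thesis by (rule power2_le_imp_le) simp
qed

definition outer :: "real^'n::finite \<Rightarrow> real^'n \<Rightarrow> real^'n^'n" where
  "outer a b = (\<chi> i j. a$i * b$j)"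

lemma outer_mult_vec: "outer a b *v v = (b \<bullet> v) *\<^sub>R a"
  by (simp add: vec_eq_iff outer_def matrix_vector_mult_def inner_vec_def sum_distrib_left
      sum_distrib_right ac_simps)

lemma norm_outer_le: "norm (outer a b) \<le> norm a * norm b"
proof -
  have "outer a b $ i = a$i *\<^sub>R b" for i by (simp add: outer_def vec_eq_iff)
  hence "(norm (outer a b))\<^sup>2 = (\<Sum>i\<in>UNIV. (norm (a$i *\<^sub>R b))\<^sup>2)"
    by (simp add: norm_sq_eq_sum_components[of "outer a b"])
  also have "\<dots> = (norm a * norm b)\<^sup>2"
    by (simp add: norm_sq_eq_sum_components[of a] power_mult_distrib sum_distrib_right)
  finally show ?thesis by simp
qed

lemma norm_componentwise_mult_le:
  fixes u v :: "real^'n::finite"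
  shows "norm (\<chi> i. u$i * v$i) \<le> norm u * norm v"
proof -
  have "norm (\<chi> i. u$i * v$i) \<le> norm (\<chi> i. u$i * norm v)"
    by (rule norm_le_componentwise_cart) (simp add: abs_mult mult_left_mono component_le_norm_cart)
  also have "(norm (\<chi> i. u$i * norm v))\<^sup>2 = (norm u * norm v)\<^sup>2"
    by (simp add: norm_sq_eq_sum_components power_mult_distrib sum_distrib_right)
  hence "norm (\<chi> i. u$i * norm v) = norm u * norm v" by (simp add: power2_eq_iff_nonneg)
  finally show ?thesis .
qed

lemma linear_sandwich: "linear (\<lambda>X::real^'n::finite^'n. Q ** X ** Q)"
proof (rule linearI)
  fix X Y :: "real^'n^'n" and c :: real
  show "Q ** (X + Y) ** Q = Q ** X ** Q + Q ** Y ** Q"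
    unfolding matrix_eq
    by (simp add: matrix_vector_mul_assoc[symmetric] matrix_vector_mult_add_rdistrib
        matrix_vector_right_distrib)
  show "Q ** (c *\<^sub>R X) ** Q = c *\<^sub>R (Q ** X ** Q)"
    unfolding matrix_eq
    by (simp add: matrix_vector_mul_assoc[symmetric] scaleR_matrix_vector_assoc[symmetric]
        matrix_vector_mult_scaleR)
qed

lemma sandwich_outer:
  fixes Q :: "real^'n::finite^'n"
  assumes "transpose Q = Q"
  shows "Q ** outer a b ** Q = outer (Q *v a) (Q *v b)"
  unfolding matrix_eq
  by (simp add: matrix_vector_mul_assoc[symmetric] outer_mult_vec matrix_vector_mult_scaleR
      symmetric_matrix_inner_commute[OF assms])

section \<open>Rank factorisation and the tangent projection\<close>

lemma orthonormal_frame: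
  fixes V :: "(real^'n::finite) set"
  assumes V: "subspace V" "dim V = CARD('m::finite)"
  obtains U :: "real^'m^'n"
  where "transpose U ** U = mat 1" "\<And>v. v \<in> V \<Longrightarrow> U *v (transpose U *v v) = v"
    "\<And>w. U *v w \<in> V"
proof -
  obtain Bv where Bv: "Bv \<subseteq> V" "pairwise orthogonal Bv" "\<And>x. x \<in> Bv \<Longrightarrow> norm x = 1"
    "independent Bv" "card Bv = dim V" "span Bv = V"
    by (rule orthonormal_basis_subspace[OF V(1)]) blast
  have "finite Bv" using Bv(4) independent_imp_finite by blast
  then obtain f where f: "bij_betw f (UNIV :: 'm set) Bv"
    using finite_same_card_bij[of "UNIV :: 'm set" Bv] Bv(5) V(2) by auto
  have fB: "f i \<in> Bv" for i using f by (auto simp: bij_betw_def)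
  have f_inner: "f i \<bullet> f j = (if i = j then 1 else 0)" for i j
  proof (cases "i = j")
    case True then show ?thesis using Bv(3)[OF fB[of i]] by (simp add: norm_eq_1)
  next
    case False
    hence "f i \<noteq> f j" using f by (auto simp: bij_betw_def inj_on_def)
    thus ?thesis using False Bv(2) fB unfolding pairwise_def orthogonal_def by metis
  qed
  define U :: "real^'m^'n" where "U = (\<chi> r i. f i $ r)"
  have Uw: "U *v w = (\<Sum>i\<in>UNIV. w$i *\<^sub>R f i)" for w
    by (simp add: U_def vec_eq_iff matrix_vector_mult_def sum_component mult.commute)
  have Utv: "transpose U *v v = (\<chi> i. f i \<bullet> v)" for v
    by (simp add: U_def vec_eq_iff matrix_vector_mult_def transpose_def inner_vec_def)
  show ?thesis
  proof
    show "transpose U ** U = mat 1"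
      by (simp add: U_def vec_eq_iff matrix_matrix_mult_def transpose_def mat_def f_inner[symmetric]
          inner_vec_def)
    show "U *v (transpose U *v v) = v" if "v \<in> V" for v
    proof -
      have "U *v (transpose U *v v) = (\<Sum>i\<in>UNIV. (v \<bullet> f i) *\<^sub>R f i)"
        unfolding Uw Utv by (simp add: inner_commute)
      also have "\<dots> = (\<Sum>b\<in>Bv. (v \<bullet> b) *\<^sub>R b)"
        by (rule sum.reindex_bij_betw[OF f])
      also have "\<dots> = v"
        by (rule orthonormal_basis_expand) (use Bv \<open>finite Bv\<close> that in auto)
      finally show ?thesis .
    qed
    show "U *v w \<in> V" for w
      unfolding Uw Bv(6)[symmetric] using fB by (intro span_sum span_scale span_base)
  qed
qed

lemma transpose_frame_mult_frame:
  fixes U :: "real^'m::finite^'n::finite"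
  assumes "transpose U ** U = mat 1"
  shows "transpose U *v (U *v w) = w"
  by (simp add: matrix_vector_mul_assoc assms)

lemma symmetric_rank_factorization:
  fixes Y :: "real^'n::finite^'n"
  assumes symY: "transpose Y = Y" and rank: "rank Y = CARD('m::finite)"
  shows "\<exists>U::real^'m^'n. transpose U ** U = mat 1 \<and>
           (\<exists>S::real^'m^'m. transpose S = S \<and> invertible S \<and> Y = U ** S ** transpose U)"
proof -
  obtain U :: "real^'m^'n" where UU: "transpose U ** U = mat 1"
    and proj: "\<And>v. v \<in> range ((*v) Y) \<Longrightarrow> U *v (transpose U *v v) = v"
    and into: "\<And>w. U *v w \<in> range ((*v) Y)"
    using orthonormal_frame[of "range ((*v) Y)"] rank
    by (metis linear_subspace_image matrix_vector_mul_linear rank_dim_range subspace_UNIV)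
  have proj_sym: "(U *v (transpose U *v a)) \<bullet> b = a \<bullet> (U *v (transpose U *v b))" for a b
    by (metis dot_lmul_matrix inner_commute transpose_matrix_vector transpose_transpose)
  have YP: "Y *v (U *v (transpose U *v v)) = Y *v v" for v
  proof -
    define d where "d = Y *v (U *v (transpose U *v v)) - Y *v v"
    have "d \<bullet> d = (Y *v d) \<bullet> (U *v (transpose U *v v)) - (Y *v d) \<bullet> v"
      unfolding d_def
      by (simp add: inner_diff_left symmetric_matrix_inner_commute[OF symY] inner_commute)
    also have "\<dots> = 0" using proj_sym[of "Y *v d" v] proj[of "Y *v d"] by simp
    finally show ?thesis unfolding d_def by simp
  qed
  define S where "S = transpose U ** Y ** U"
  have Y_eq: "Y = U ** S ** transpose U"
    unfolding matrix_eq S_def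
    by (simp add: matrix_vector_mul_assoc[symmetric] proj YP del: transpose_matrix_vector)
  have "transpose S = S" unfolding S_def by (simp add: matrix_transpose_mul symY matrix_mul_assoc)
  moreover have "invertible S"
    unfolding invertible_left_inverse matrix_left_invertible_ker
  proof (intro allI impI)
    fix w assume "S *v w = 0"
    hence YUw: "Y *v (U *v w) = 0"
      by (subst Y_eq) (simp add: matrix_vector_mul_assoc[symmetric] transpose_frame_mult_frame[OF UU]
          del: transpose_matrix_vector)
    obtain z where z: "U *v w = Y *v z" using into by blast
    have "(Y *v z) \<bullet> (Y *v z) = 0"
      using YUw z symmetric_matrix_inner_commute[OF symY, of z "Y *v z"] by simp
    hence "U *v w = 0" using z by simp
    thus "w = 0" using transpose_frame_mult_frame[OF UU, of w] by simp
  qed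
  ultimately show ?thesis using UU Y_eq by blast
qed

definition tangent_complement :: "real^'m::finite^'n::finite \<Rightarrow> real^'n^'n" where
  "tangent_complement U = mat 1 - U ** transpose U"

lemma tangent_complement_mult_vec:
  "tangent_complement U *v v = v - U *v (transpose U *v v)"
  unfolding tangent_complement_def
  by (simp add: matrix_vector_mult_diff_rdistrib matrix_vector_mul_assoc[symmetric]
      del: transpose_matrix_vector)

lemma tangent_complement_symmetric: "transpose (tangent_complement U) = tangent_complement U"
  unfolding tangent_complement_def
  by (simp add: transpose_def matrix_matrix_mult_def vec_eq_iff mat_def mult.commute)

context
  fixes U :: "real^'m::finite^'n::finite"
  assumes UU: "transpose U ** U = mat 1"
begin

lemma transpose_mult_tangent_complement: "transpose U *v (tangent_complement U *v v) = 0"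
  unfolding tangent_complement_mult_vec
  by (simp add: matrix_vector_mult_diff_distrib transpose_frame_mult_frame[OF UU]
      del: transpose_matrix_vector)

lemma tangent_complement_annihilates:
  assumes "Y = U ** S ** transpose U"
  shows "tangent_complement U *v (Y *v v) = 0" "Y *v (tangent_complement U *v v) = 0"
proof -
  have "Y *v v = U *v (S *v (transpose U *v v))" for v
    unfolding assms by (simp add: matrix_vector_mul_assoc[symmetric] del: transpose_matrix_vector)
  thus "tangent_complement U *v (Y *v v) = 0" "Y *v (tangent_complement U *v v) = 0"
    by (simp_all add: tangent_complement_mult_vec transpose_frame_mult_frame[OF UU]
        matrix_vector_mult_diff_distrib del: transpose_matrix_vector)
qed

lemma norm_tangent_complement_le: "norm (tangent_complement U *v v) \<le> norm v"
proof -
  define p where "p = U *v (transpose U *v v)"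
  have "p \<bullet> (v - p) = 0"
    using transpose_mult_tangent_complement[of v]
    unfolding p_def tangent_complement_mult_vec
    by (metis dot_lmul_matrix inner_commute inner_zero_right transpose_matrix_vector)
  hence "(norm v)\<^sup>2 = (norm (v - p))\<^sup>2 + (norm p)\<^sup>2"
    by (simp add: power2_norm_eq_inner inner_diff_left inner_diff_right inner_commute)
  hence "(norm (v - p))\<^sup>2 \<le> (norm v)\<^sup>2" by simp
  hence "norm (v - p) \<le> norm v" by (rule power2_le_imp_le) simp
  thus ?thesis unfolding tangent_complement_mult_vec p_def .
qed

end

lemma rank_add_le_if_orthogonal_ranges:
  fixes R Y M :: "real^'n::finite^'m::finite"
  assumes "range ((*v) Y) \<subseteq> range ((*v) R)" "range ((*v) M) \<subseteq> range ((*v) R)"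
    and "\<And>u w. (Y *v u) \<bullet> (M *v w) = 0"
  shows "rank Y + rank M \<le> rank R"
  unfolding rank_dim_range
  using assms dim_orthogonal_sum[of "range ((*v) Y)" "range ((*v) M)"]
    dim_subset[of "range ((*v) Y) \<union> range ((*v) M)" "range ((*v) R)"]
  by (metis (no_types, lifting) Un_subset_iff rangeE)

text \<open>R = \<gamma> Y + Q R Q where the ranges of Y and of Q R Q are orthogonal and both lie in the range
  of R; the rank bound leaves no room for Q R Q.\<close>
lemma eq_scaled_if_tangent_part_scaled:
  fixes R Y :: "real^'n::finite^'n" and U :: "real^'m::finite^'n"
  assumes UU: "transpose U ** U = mat 1" and Y: "Y = U ** S ** transpose U"
    and rank: "rank R \<le> rank Y"
    and tangent: "R - tangent_complement U ** R ** tangent_complement U = \<gamma> *\<^sub>R Y"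
    and \<gamma>: "\<gamma> \<noteq> 0"
  shows "R = \<gamma> *\<^sub>R Y"
proof -
  define Q where "Q = tangent_complement U"
  define M where "M = Q ** R ** Q"
  have R_eq: "R *v v = \<gamma> *\<^sub>R (Y *v v) + M *v v" for v
  proof -
    have "R = \<gamma> *\<^sub>R Y + M" using tangent unfolding M_def Q_def by (simp add: algebra_simps)
    thus ?thesis by (simp add: matrix_vector_mult_add_rdistrib scaleR_matrix_vector_assoc[symmetric])
  qed
  have QU: "Q *v (U *v w) = 0" for w
    unfolding Q_def tangent_complement_mult_vec transpose_frame_mult_frame[OF UU] by simp
  have QY: "Q *v (Y *v v) = 0" "Y *v (Q *v v) = 0" for v
    unfolding Q_def using tangent_complement_annihilates[OF UU Y] by auto
  have QQ: "Q *v (Q *v v) = Q *v v" for v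
    unfolding Q_def tangent_complement_mult_vec[of U "tangent_complement U *v v"]
      transpose_mult_tangent_complement[OF UU] by simp
  have "Y *v v \<in> range ((*v) R)" for v
  proof -
    have "Y *v (U *v (transpose U *v v)) = Y *v v"
      unfolding Y by (simp add: matrix_vector_mul_assoc[symmetric] transpose_frame_mult_frame[OF UU]
          del: transpose_matrix_vector)
    hence "R *v ((1 / \<gamma>) *\<^sub>R (U *v (transpose U *v v))) = Y *v v"
      unfolding R_eq using \<gamma> by (simp add: M_def matrix_vector_mul_assoc[symmetric] QU
          matrix_vector_mult_scaleR del: transpose_matrix_vector)
    thus ?thesis by (metis rangeI)
  qed
  moreover have "M *v v \<in> range ((*v) R)" for v
  proof -
    have "R *v (Q *v v) = M *v v"
      unfolding R_eq QY(2) by (simp add: M_def matrix_vector_mul_assoc[symmetric] QQ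
          del: transpose_matrix_vector)
    thus ?thesis by (metis rangeI)
  qed
  moreover have "(Y *v u) \<bullet> (M *v w) = 0" for u w
  proof -
    have "(Y *v u) \<bullet> (M *v w) = (Q *v (Y *v u)) \<bullet> (R *v (Q *v w))"
      using symmetric_matrix_inner_commute[OF tangent_complement_symmetric[of U]]
      unfolding M_def Q_def by (simp add: matrix_vector_mul_assoc[symmetric] del: transpose_matrix_vector)
    thus ?thesis using QY by simp
  qed
  ultimately have "rank Y + rank M \<le> rank R"
    by (intro rank_add_le_if_orthogonal_ranges) blast+
  hence "rank M = 0" using rank by linarith
  hence "M = 0" by (simp add: rank_eq_0)
  thus ?thesis using tangent unfolding M_def Q_def by simp
qed

definition frame :: "real^'n::finite^'n \<Rightarrow> real^4^'n" where
  "frame Y = (SOME U::real^4^'n. transpose U ** U = mat 1 \<and>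
     (\<exists>S::real^4^4. transpose S = S \<and> invertible S \<and> Y = U ** S ** transpose U))"

lemma PY_eq: "PY Y A = A - tangent_complement (frame Y) ** A ** tangent_complement (frame Y)"
  unfolding PY_def Let_def frame_def tangent_complement_def ..

lemma frame:
  fixes Y :: "real^'n::finite^'n"
  assumes "transpose Y = Y" "rank Y = 4"
  obtains S where "transpose (frame Y) ** frame Y = mat 1" "Y = frame Y ** S ** transpose (frame Y)"
proof -
  have "\<exists>U::real^4^'n. transpose U ** U = mat 1 \<and>
           (\<exists>S::real^4^4. transpose S = S \<and> invertible S \<and> Y = U ** S ** transpose U)"
    by (rule symmetric_rank_factorization) (use assms in simp_all)
  from someI_ex[OF this] show ?thesis using that unfolding frame_def by blast
qed

section \<open>The matrix R\<close>

definition one_vec :: "real^'n::finite" where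
  "one_vec = (\<chi> i. 1)"

definition zvec :: "real^'n::finite \<Rightarrow> real^'n \<Rightarrow> real^'n" where
  "zvec x y = (\<chi> i. x$i * x$i - y$i * y$i)"

definition Rform :: "real^'n::finite \<Rightarrow> real^'n \<Rightarrow> real^'n^'n" where
  "Rform x y = (1/2) *\<^sub>R (outer (zvec x y) one_vec + outer one_vec (zvec x y)) - outer x x + outer y y"

lemma Rmat_eq:
  "Rmat k W \<epsilon> E = Rform (unit_eigvec (laplacian (W + \<epsilon> *\<^sub>R E)) (k + 1))
                         (unit_eigvec (laplacian (W + \<epsilon> *\<^sub>R E)) k)"
  unfolding Rmat_def Let_def Rform_def unit_eigvec_def
  by (simp add: vec_eq_iff outer_def zvec_def one_vec_def field_simps)

lemma Rform_mult_vec: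
  "Rform x y *v v = (1/2) *\<^sub>R ((one_vec \<bullet> v) *\<^sub>R zvec x y + (zvec x y \<bullet> v) *\<^sub>R one_vec)
     - (x \<bullet> v) *\<^sub>R x + (y \<bullet> v) *\<^sub>R y"
  unfolding Rform_def
  by (simp add: matrix_vector_mult_add_rdistrib matrix_vector_mult_diff_rdistrib outer_mult_vec
      scaleR_matrix_vector_assoc[symmetric])

lemma range_Rform_subset: "range ((*v) (Rform x y)) \<subseteq> span {zvec x y, one_vec, x, y}"
proof (rule image_subsetI)
  fix v
  show "Rform x y *v v \<in> span {zvec x y, one_vec, x, y}"
    unfolding Rform_mult_vec by (intro span_add span_diff span_scale span_base) auto
qed

lemma rank_Rform_4_imp_in_range:
  assumes "rank (Rform x y) = 4"
  shows "{zvec x y, one_vec, x, y} \<subseteq> range ((*v) (Rform x y))"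
proof -
  define V where "V = range ((*v) (Rform x y))"
  have "dim (span {zvec x y, one_vec, x, y}) \<le> card {zvec x y, one_vec, x, y}"
    by (subst dim_span) (rule dim_le_card', simp)
  also have "\<dots> \<le> 4"
    by (rule order_trans[OF card_insert_le_m1]) (auto simp: card_insert_le_m1)
  also have "\<dots> = dim V" using assms unfolding V_def rank_dim_range ..
  finally have "dim (span {zvec x y, one_vec, x, y}) \<le> dim V" .
  moreover have "subspace V" unfolding V_def
    by (rule linear_subspace_image) (auto simp: subspace_UNIV)
  ultimately have "V = span {zvec x y, one_vec, x, y}"
    using subspace_dim_equal[OF _ subspace_span range_Rform_subset[of x y]] unfolding V_def by blast
  thus ?thesis unfolding V_def by (auto intro: span_base)
qed

section \<open>The Laplacian\<close>

lemma linear_laplacian: "linear (laplacian :: real^'n::finite^'n \<Rightarrow> _)"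
  by (rule linearI)
    (simp_all add: laplacian_def vec_eq_iff sum.distrib algebra_simps sum_distrib_left)

lemma laplacian_symmetric:
  fixes X :: "real^'n::finite^'n"
  assumes "transpose X = X"
  shows "transpose (laplacian X) = laplacian X"
proof -
  have "X$j$i = X$i$j" for i j using assms by (metis transpose_def vec_lambda_beta)
  thus ?thesis unfolding laplacian_def by (simp add: vec_eq_iff transpose_def)
qed

lemma symmetric_add_scaled:
  fixes X Y :: "real^'n::finite^'n"
  assumes "transpose X = X" "transpose Y = Y"
  shows "transpose (X + c *\<^sub>R Y) = X + c *\<^sub>R Y"
  using assms by (simp add: transpose_def vec_eq_iff)

lemma norm_PiS_le: "norm (PiS Es X) \<le> norm X"
  by (intro norm_le_componentwise_cart) (simp add: PiS_def component_le_norm_cart)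

lemma PiS_diff: "PiS Es X - PiS Es Y = PiS Es (X - Y)"
  unfolding PiS_def by (simp add: vec_eq_iff)

lemma norm_unit_eigvec_laplacian:
  fixes W Y :: "'n::finite mat"
  assumes "symm W" "PiS Es Y \<in> calE1 Es" "1 \<le> j" "j \<le> CARD('n)"
  shows "norm (unit_eigvec (laplacian (W + \<epsilon> *\<^sub>R PiS Es Y)) j) = 1"
proof -
  have "transpose (laplacian (W + \<epsilon> *\<^sub>R PiS Es Y)) = laplacian (W + \<epsilon> *\<^sub>R PiS Es Y)"
    using assms(1,2) by (intro laplacian_symmetric symmetric_add_scaled) (auto simp: calE1_def symm_def)
  thus ?thesis using unit_eigvec(1) assms(3,4) by blast
qed

lemma laplacian_unit_eigvec_lipschitz:
  fixes W E0 :: "real^'n::finite^'n"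
  assumes W: "transpose W = W" and E0: "transpose E0 = E0" and j: "1 \<le> j" "j \<le> CARD('n)"
    and simple: "simple_eig (laplacian (W + \<epsilon> *\<^sub>R E0)) j"
  obtains a r where "0 \<le> a" "0 < r"
    "\<And>E. transpose E = E \<Longrightarrow> norm (E - E0) < r \<Longrightarrow> \<exists>s::real. (s = 1 \<or> s = -1) \<and>
       norm (unit_eigvec (laplacian (W + \<epsilon> *\<^sub>R E)) j - s *\<^sub>R unit_eigvec (laplacian (W + \<epsilon> *\<^sub>R E0)) j)
         \<le> a * norm (E - E0)"
proof -
  define A0 where "A0 = laplacian (W + \<epsilon> *\<^sub>R E0)"
  have symA0: "transpose A0 = A0" unfolding A0_def by (intro laplacian_symmetric symmetric_add_scaled W E0)
  obtain g where g: "g > 0" and perturb: "\<And>C \<eta>. transpose C = C \<Longrightarrow>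
      (\<And>v. norm ((C - A0) *v v) \<le> \<eta> * norm v) \<Longrightarrow> \<eta> \<le> g / 2 \<Longrightarrow>
      \<exists>s::real. (s = 1 \<or> s = -1) \<and> norm (unit_eigvec C j - s *\<^sub>R unit_eigvec A0 j) \<le> (4 / g) * \<eta>"
    using unit_eigvec_perturb[OF symA0 j] simple unfolding simple_eig_def A0_def by metis
  obtain K where K: "K > 0" "\<And>X::real^'n^'n. norm (laplacian X) \<le> norm X * K"
    using bounded_linear.pos_bounded linear_conv_bounded_linear linear_laplacian by blast
  define L where "L = K * (\<bar>\<epsilon>\<bar> + 1)"
  have L: "L > 0" unfolding L_def using K(1) by (simp add: add_pos_nonneg)
  show ?thesis
  proof (rule that[of "4 / g * L" "g / (2 * L)"])
    show "0 \<le> 4 / g * L" "0 < g / (2 * L)" using g L by simp_all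
    fix E :: "real^'n^'n"
    assume symE: "transpose E = E" and close: "norm (E - E0) < g / (2 * L)"
    define C where "C = laplacian (W + \<epsilon> *\<^sub>R E)"
    have "C - A0 = laplacian (\<epsilon> *\<^sub>R (E - E0))"
      unfolding C_def A0_def linear_diff[OF linear_laplacian, symmetric]
      by (simp add: algebra_simps)
    hence "norm (C - A0) \<le> (K * \<bar>\<epsilon>\<bar>) * norm (E - E0)"
      using K(2)[of "\<epsilon> *\<^sub>R (E - E0)"] by (simp add: ac_simps)
    also have "\<dots> \<le> L * norm (E - E0)"
      unfolding L_def using K(1) by (intro mult_right_mono) simp_all
    finally have "norm (C - A0) \<le> L * norm (E - E0)" .
    hence "norm ((C - A0) *v v) \<le> (L * norm (E - E0)) * norm v" for v
      by (meson norm_matrix_vector_le mult_right_mono norm_ge_zero order_trans)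
    moreover have "L * norm (E - E0) \<le> g / 2" using close L by (simp add: field_simps)
    moreover have "transpose C = C" unfolding C_def by (intro laplacian_symmetric symmetric_add_scaled W symE)
    ultimately show "\<exists>s::real. (s = 1 \<or> s = -1) \<and>
       norm (unit_eigvec (laplacian (W + \<epsilon> *\<^sub>R E)) j - s *\<^sub>R unit_eigvec (laplacian (W + \<epsilon> *\<^sub>R E0)) j)
         \<le> 4 / g * L * norm (E - E0)"
      using perturb[of C "L * norm (E - E0)"] unfolding C_def A0_def by (simp add: mult.assoc)
  qed
qed

section \<open>Quadratic estimate near a stationary point\<close>

lemma stationary_range_Rmat_subset:
  fixes Ystar :: "real^'n::finite^'n"
  assumes sym: "symm Ystar" and rank: "rank Ystar = 4"
    and stationary: "ode_rhs Es k W \<epsilon> Ystar = 0"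
    and R_rank: "rank (Rmat k W \<epsilon> (PiS Es Ystar)) = 4"
    and PR_nonzero: "PY Ystar (Rmat k W \<epsilon> (PiS Es Ystar)) \<noteq> 0"
  shows "range ((*v) (Rmat k W \<epsilon> (PiS Es Ystar))) \<subseteq> range ((*v) Ystar)"
proof -
  define R where "R = Rmat k W \<epsilon> (PiS Es Ystar)"
  define \<gamma> where "\<gamma> = frob_inner (PY Ystar R) (PiS Es Ystar)"
  have tangent: "PY Ystar R = \<gamma> *\<^sub>R Ystar"
    using stationary unfolding ode_rhs_def Let_def R_def \<gamma>_def by (simp add: algebra_simps)
  hence "\<gamma> \<noteq> 0" using PR_nonzero unfolding R_def by auto
  moreover obtain S where "transpose (frame Ystar) ** frame Ystar = mat 1"
    "Ystar = frame Ystar ** S ** transpose (frame Ystar)"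
    using frame sym rank unfolding symm_def by blast
  moreover have "rank R \<le> rank Ystar" using R_rank rank unfolding R_def by simp
  ultimately have "R = \<gamma> *\<^sub>R Ystar"
    using eq_scaled_if_tangent_part_scaled tangent unfolding PY_eq by blast
  hence "R *v v = Ystar *v (\<gamma> *\<^sub>R v)" for v
    by (simp add: matrix_vector_mult_scaleR scaleR_matrix_vector_assoc[symmetric])
  thus ?thesis unfolding R_def by (metis image_subsetI rangeI)
qed

lemma zvec_sign_invariant:
  assumes "s = 1 \<or> s = -1" "t = 1 \<or> t = -1"
  shows "zvec (s *\<^sub>R x) (t *\<^sub>R y) = zvec x y"
  using assms unfolding zvec_def by (auto simp: vec_eq_iff)

lemma norm_zvec_diff_le:
  fixes a b c d :: "real^'n::finite"
  assumes "norm a = 1" "norm b = 1" "norm c = 1" "norm d = 1"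
  shows "norm (zvec a b - zvec c d) \<le> 2 * norm (a - c) + 2 * norm (b - d)"
proof -
  have "zvec a b - zvec c d = (\<chi> i. (a - c)$i * (a + c)$i) - (\<chi> i. (b - d)$i * (b + d)$i)"
    unfolding zvec_def by (simp add: vec_eq_iff algebra_simps)
  hence "norm (zvec a b - zvec c d)
      \<le> norm (\<chi> i. (a - c)$i * (a + c)$i) + norm (\<chi> i. (b - d)$i * (b + d)$i)"
    by (simp add: norm_triangle_ineq4)
  also have "\<dots> \<le> norm (a - c) * norm (a + c) + norm (b - d) * norm (b + d)"
    by (intro add_mono norm_componentwise_mult_le)
  also have "\<dots> \<le> norm (a - c) * 2 + norm (b - d) * 2"
    using norm_triangle_ineq[of a c] norm_triangle_ineq[of b d] assms
    by (intro add_mono mult_left_mono) simp_all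
  finally show ?thesis by simp
qed

lemma norm_sandwich_Rform_le:
  fixes Q :: "real^'n::finite^'n"
  assumes "transpose Q = Q"
  shows "norm (Q ** Rform x y ** Q)
           \<le> norm (Q *v zvec x y) * norm (Q *v one_vec) + (norm (Q *v x))\<^sup>2 + (norm (Q *v y))\<^sup>2"
proof -
  have "Q ** Rform x y ** Q
      = (1/2) *\<^sub>R (outer (Q *v zvec x y) (Q *v one_vec) + outer (Q *v one_vec) (Q *v zvec x y))
        - outer (Q *v x) (Q *v x) + outer (Q *v y) (Q *v y)"
    unfolding Rform_def
    by (simp add: linear_add[OF linear_sandwich] linear_diff[OF linear_sandwich]
        linear_scale[OF linear_sandwich] sandwich_outer[OF assms])
  also have "norm \<dots> \<le> (1/2) * (norm (outer (Q *v zvec x y) (Q *v one_vec))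
      + norm (outer (Q *v one_vec) (Q *v zvec x y))) + norm (outer (Q *v x) (Q *v x))
      + norm (outer (Q *v y) (Q *v y))"
  proof -
    have "norm ((1/2) *\<^sub>R (p + q) - r + t) \<le> (1/2) * (norm p + norm q) + norm r + norm t"
      for p q r t :: "real^'n^'n"
    proof -
      have "norm ((1/2) *\<^sub>R (p + q) - r + t) \<le> norm ((1/2) *\<^sub>R (p + q) - r) + norm t"
        by (rule norm_triangle_ineq)
      also have "\<dots> \<le> norm ((1/2) *\<^sub>R (p + q)) + norm r + norm t"
        using norm_triangle_ineq4[of "(1/2) *\<^sub>R (p + q)" r] by simp
      finally have "norm ((1/2) *\<^sub>R (p + q) - r + t) \<le> norm ((1/2) *\<^sub>R (p + q)) + norm r + norm t" .
      moreover have "norm ((1/2) *\<^sub>R (p + q)) \<le> (1/2) * (norm p + norm q)"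
        using norm_triangle_ineq[of p q] by simp
      ultimately show ?thesis by linarith
    qed
    thus ?thesis .
  qed
  also have "\<dots> \<le> norm (Q *v zvec x y) * norm (Q *v one_vec) + (norm (Q *v x))\<^sup>2 + (norm (Q *v y))\<^sup>2"
  proof (intro add_mono)
    have "norm (outer (Q *v zvec x y) (Q *v one_vec)) + norm (outer (Q *v one_vec) (Q *v zvec x y))
        \<le> 2 * (norm (Q *v zvec x y) * norm (Q *v one_vec))"
      using norm_outer_le[of "Q *v zvec x y" "Q *v one_vec"] norm_outer_le[of "Q *v one_vec" "Q *v zvec x y"]
      by (simp add: mult.commute)
    thus "(1/2) * (norm (outer (Q *v zvec x y) (Q *v one_vec)) + norm (outer (Q *v one_vec) (Q *v zvec x y)))
        \<le> norm (Q *v zvec x y) * norm (Q *v one_vec)" by simp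
  qed (simp_all add: norm_outer_le power2_eq_square)
  finally show ?thesis .
qed

lemma norm_annihilator_le:
  fixes Q Y Yh :: "real^'n::finite^'n"
  assumes contr: "\<And>u. norm (Q *v u) \<le> norm u" and annih: "\<And>u. Q *v (Yh *v u) = 0"
    and s: "s = 1 \<or> s = -1"
  shows "norm (Q *v v) \<le> norm (v - s *\<^sub>R (Y *v w)) + norm (Yh - Y) * norm w"
proof -
  have "norm (Q *v v) = norm (Q *v (s *\<^sub>R v))" using s by (auto simp: matrix_vector_mult_scaleR)
  also have "Q *v (s *\<^sub>R v) = Q *v (s *\<^sub>R v - Y *v w) - Q *v ((Yh - Y) *v w)"
    using annih[of w] by (simp add: matrix_vector_mult_diff_distrib matrix_vector_mult_diff_rdistrib)
  also have "norm \<dots> \<le> norm (s *\<^sub>R v - Y *v w) + norm ((Yh - Y) *v w)"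
    by (rule order_trans[OF norm_triangle_ineq4 add_mono[OF contr contr]])
  also have "norm (s *\<^sub>R v - Y *v w) = norm (v - s *\<^sub>R (Y *v w))"
    using s by (auto simp: norm_minus_commute add.commute)
  finally show ?thesis using norm_matrix_vector_le[of "Yh - Y" w] by simp
qed

lemma norm_sandwich_Rform_quadratic:
  fixes Q Y Yh :: "real^'n::finite^'n"
  assumes Q: "transpose Q = Q" "\<And>u. norm (Q *v u) \<le> norm u" "\<And>u. Q *v (Yh *v u) = 0"
    and unit: "norm x = 1" "norm y = 1" "norm x0 = 1" "norm y0 = 1"
    and pre: "zvec x0 y0 = Y *v wz" "one_vec = Y *v w1" "x0 = Y *v wx" "y0 = Y *v wy"
    and near: "s1 = 1 \<or> s1 = -1" "norm (x - s1 *\<^sub>R x0) \<le> a * norm (Yh - Y)"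
      "s2 = 1 \<or> s2 = -1" "norm (y - s2 *\<^sub>R y0) \<le> a * norm (Yh - Y)"
    and a: "0 \<le> a"
  shows "norm (Q ** Rform x y ** Q)
           \<le> 3 * (4 * a + norm wz + norm w1 + norm wx + norm wy)\<^sup>2 * (norm (Yh - Y))\<^sup>2"
proof -
  define \<delta> where "\<delta> = norm (Yh - Y)"
  define c where "c = 4 * a + norm wz + norm w1 + norm wx + norm wy"
  have \<delta>: "0 \<le> \<delta>" unfolding \<delta>_def by simp
  have one: "(1::real) = 1 \<or> (1::real) = -1" by simp
  have c\<delta>: "c * \<delta> = 4 * (a * \<delta>) + norm wz * \<delta> + norm w1 * \<delta> + norm wx * \<delta> + norm wy * \<delta>"
    unfolding c_def by (simp add: algebra_simps)
  have nonneg: "0 \<le> a * \<delta>" "0 \<le> norm wz * \<delta>" "0 \<le> norm w1 * \<delta>" "0 \<le> norm wx * \<delta>"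
    "0 \<le> norm wy * \<delta>" using a \<delta> by simp_all
  have "norm (Q *v x) \<le> c * \<delta>"
    using norm_annihilator_le[OF Q(2,3) near(1), of x Y wx] near(2) nonneg
    unfolding pre c\<delta> \<delta>_def[symmetric] by (simp add: mult.commute)
  moreover have "norm (Q *v y) \<le> c * \<delta>"
    using norm_annihilator_le[OF Q(2,3) near(3), of y Y wy] near(4) nonneg
    unfolding pre c\<delta> \<delta>_def[symmetric] by (simp add: mult.commute)
  moreover have "norm (Q *v one_vec) \<le> c * \<delta>"
    using norm_annihilator_le[OF Q(2,3) one, of one_vec Y w1] nonneg
    unfolding pre c\<delta> \<delta>_def[symmetric] by (simp add: mult.commute)
  moreover have "norm (Q *v zvec x y) \<le> c * \<delta>"
  proof -
    have "zvec x y = zvec (s1 *\<^sub>R x) (s2 *\<^sub>R y)" by (simp only: zvec_sign_invariant[OF near(1,3)])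
    moreover have "norm (s1 *\<^sub>R x - x0) = norm (x - s1 *\<^sub>R x0)" "norm (s2 *\<^sub>R y - y0) = norm (y - s2 *\<^sub>R y0)"
      using near(1,3) by (auto simp: norm_minus_commute add.commute)
    ultimately have "norm (zvec x y - zvec x0 y0) \<le> 4 * (a * \<delta>)"
      using norm_zvec_diff_le[of "s1 *\<^sub>R x" "s2 *\<^sub>R y" x0 y0] unit near(1-4) unfolding \<delta>_def
      by auto
    thus ?thesis
      using norm_annihilator_le[OF Q(2,3) one, of "zvec x y" Y wz] nonneg
      unfolding pre(1)[symmetric] c\<delta> \<delta>_def[symmetric] by (simp add: mult.commute)
  qed
  ultimately have "norm (Q *v zvec x y) * norm (Q *v one_vec) + (norm (Q *v x))\<^sup>2 + (norm (Q *v y))\<^sup>2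
                     \<le> (c * \<delta>) * (c * \<delta>) + (c * \<delta>)\<^sup>2 + (c * \<delta>)\<^sup>2"
    using nonneg c\<delta> by (intro add_mono mult_mono power_mono) auto
  thus ?thesis
    using norm_sandwich_Rform_le[OF Q(1), of x y] unfolding c_def[symmetric] \<delta>_def[symmetric]
    by (simp add: power2_eq_square algebra_simps)
qed

lemma PY_Rform_defect_quadratic:
  fixes Y Yh :: "real^'n::finite^'n"
  assumes Yh: "transpose Yh = Yh" "rank Yh = 4"
    and unit: "norm x = 1" "norm y = 1" "norm x0 = 1" "norm y0 = 1"
    and pre: "zvec x0 y0 = Y *v wz" "one_vec = Y *v w1" "x0 = Y *v wx" "y0 = Y *v wy"
    and near: "s1 = 1 \<or> s1 = -1" "norm (x - s1 *\<^sub>R x0) \<le> a * norm (Yh - Y)"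
      "s2 = 1 \<or> s2 = -1" "norm (y - s2 *\<^sub>R y0) \<le> a * norm (Yh - Y)"
    and a: "0 \<le> a"
  shows "norm (PY Yh (Rform x y) - Rform x y)
           \<le> 3 * (4 * a + norm wz + norm w1 + norm wx + norm wy)\<^sup>2 * (norm (Yh - Y))\<^sup>2"
proof -
  obtain S where UU: "transpose (frame Yh) ** frame Yh = mat 1"
    and Yh_eq: "Yh = frame Yh ** S ** transpose (frame Yh)"
    using frame Yh by blast
  have "norm (PY Yh (Rform x y) - Rform x y)
      = norm (tangent_complement (frame Yh) ** Rform x y ** tangent_complement (frame Yh))"
    unfolding PY_eq by (simp add: norm_minus_commute)
  also have "\<dots> \<le> 3 * (4 * a + norm wz + norm w1 + norm wx + norm wy)\<^sup>2 * (norm (Yh - Y))\<^sup>2"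
    by (rule norm_sandwich_Rform_quadratic[OF tangent_complement_symmetric
          norm_tangent_complement_le[OF UU] tangent_complement_annihilates(1)[OF UU Yh_eq]
          unit pre near a])
  finally show ?thesis .
qed

context
  fixes Es :: "('n::finite \<times> 'n) set" and W Ystar :: "'n mat" and k :: nat and \<epsilon> :: real
begin

lemma stationary_point_preimages:
  assumes "symm Ystar" "rank Ystar = 4" "ode_rhs Es k W \<epsilon> Ystar = 0"
    and R_rank: "rank (Rmat k W \<epsilon> (PiS Es Ystar)) = 4"
    and "PY Ystar (Rmat k W \<epsilon> (PiS Es Ystar)) \<noteq> 0"
  defines "A \<equiv> laplacian (W + \<epsilon> *\<^sub>R PiS Es Ystar)"
  obtains wz w1 wx wy
  where "zvec (unit_eigvec A (k + 1)) (unit_eigvec A k) = Ystar *v wz" "one_vec = Ystar *v w1"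
    "unit_eigvec A (k + 1) = Ystar *v wx" "unit_eigvec A k = Ystar *v wy"
proof -
  have "{zvec (unit_eigvec A (k + 1)) (unit_eigvec A k), one_vec, unit_eigvec A (k + 1), unit_eigvec A k}
      \<subseteq> range ((*v) Ystar)"
    using rank_Rform_4_imp_in_range R_rank stationary_range_Rmat_subset[OF assms(1-5)]
    unfolding Rmat_eq A_def by blast
  thus ?thesis using that by (simp add: image_iff) metis
qed

lemma laplacian_eigvecs_near:
  assumes W: "symm W" and E: "PiS Es Ystar \<in> calE1 Es" and k: "1 \<le> k" "k + 1 \<le> CARD('n)"
    and simple: "simple_eig (laplacian (W + \<epsilon> *\<^sub>R PiS Es Ystar)) k"
      "simple_eig (laplacian (W + \<epsilon> *\<^sub>R PiS Es Ystar)) (k + 1)"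
  defines "A \<equiv> \<lambda>Y. laplacian (W + \<epsilon> *\<^sub>R PiS Es Y)"
  obtains a r where "0 \<le> a" "0 < r"
    "\<And>Yh. PiS Es Yh \<in> calE1 Es \<Longrightarrow> norm (Yh - Ystar) < r \<Longrightarrow>
       \<exists>s1 s2 :: real. (s1 = 1 \<or> s1 = -1) \<and> (s2 = 1 \<or> s2 = -1) \<and>
         norm (unit_eigvec (A Yh) (k + 1) - s1 *\<^sub>R unit_eigvec (A Ystar) (k + 1)) \<le> a * norm (Yh - Ystar) \<and>
         norm (unit_eigvec (A Yh) k - s2 *\<^sub>R unit_eigvec (A Ystar) k) \<le> a * norm (Yh - Ystar)"
proof -
  have symW: "transpose W = W" and symE: "transpose (PiS Es Ystar) = PiS Es Ystar"
    using W E unfolding symm_def calE1_def by auto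
  obtain a1 r1 where a1: "0 \<le> a1" "0 < r1" and near1: "\<And>E. transpose E = E \<Longrightarrow> norm (E - PiS Es Ystar) < r1 \<Longrightarrow>
      \<exists>s::real. (s = 1 \<or> s = -1) \<and> norm (unit_eigvec (laplacian (W + \<epsilon> *\<^sub>R E)) (k + 1)
        - s *\<^sub>R unit_eigvec (A Ystar) (k + 1)) \<le> a1 * norm (E - PiS Es Ystar)"
    using laplacian_unit_eigvec_lipschitz[OF symW symE _ _ simple(2)] k unfolding A_def by auto
  obtain a2 r2 where a2: "0 \<le> a2" "0 < r2" and near2: "\<And>E. transpose E = E \<Longrightarrow> norm (E - PiS Es Ystar) < r2 \<Longrightarrow>
      \<exists>s::real. (s = 1 \<or> s = -1) \<and> norm (unit_eigvec (laplacian (W + \<epsilon> *\<^sub>R E)) k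
        - s *\<^sub>R unit_eigvec (A Ystar) k) \<le> a2 * norm (E - PiS Es Ystar)"
    using laplacian_unit_eigvec_lipschitz[OF symW symE _ _ simple(1)] k unfolding A_def by auto
  show ?thesis
  proof (rule that[of "max a1 a2" "min r1 r2"])
    show "0 \<le> max a1 a2" "0 < min r1 r2" using a1 a2 by auto
    fix Yh assume Eh: "PiS Es Yh \<in> calE1 Es" and close: "norm (Yh - Ystar) < min r1 r2"
    have symEh: "transpose (PiS Es Yh) = PiS Es Yh" using Eh unfolding calE1_def symm_def by simp
    have dist: "norm (PiS Es Yh - PiS Es Ystar) \<le> norm (Yh - Ystar)"
      unfolding PiS_diff by (rule norm_PiS_le)
    have scale: "a * norm (PiS Es Yh - PiS Es Ystar) \<le> max a1 a2 * norm (Yh - Ystar)" if "0 \<le> a" "a \<le> max a1 a2" for a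
      using that dist by (intro mult_mono) auto
    show "\<exists>s1 s2 :: real. (s1 = 1 \<or> s1 = -1) \<and> (s2 = 1 \<or> s2 = -1) \<and>
         norm (unit_eigvec (A Yh) (k + 1) - s1 *\<^sub>R unit_eigvec (A Ystar) (k + 1)) \<le> max a1 a2 * norm (Yh - Ystar) \<and>
         norm (unit_eigvec (A Yh) k - s2 *\<^sub>R unit_eigvec (A Ystar) k) \<le> max a1 a2 * norm (Yh - Ystar)"
      using near1[OF symEh] near2[OF symEh] dist close scale[of a1] scale[of a2] a1 a2
      unfolding A_def by (smt (verit, best))
  qed
qed

lemma quadratic_defect_near:
  assumes W: "symm W" and E: "PiS Es Ystar \<in> calE1 Es" and k: "1 \<le> k" "k + 1 \<le> CARD('n)"
    and simple: "simple_eig (laplacian (W + \<epsilon> *\<^sub>R PiS Es Ystar)) k"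
      "simple_eig (laplacian (W + \<epsilon> *\<^sub>R PiS Es Ystar)) (k + 1)"
  defines "A \<equiv> \<lambda>Y. laplacian (W + \<epsilon> *\<^sub>R PiS Es Y)"
  assumes pre: "zvec (unit_eigvec (A Ystar) (k + 1)) (unit_eigvec (A Ystar) k) = Ystar *v wz"
    "one_vec = Ystar *v w1" "unit_eigvec (A Ystar) (k + 1) = Ystar *v wx"
    "unit_eigvec (A Ystar) k = Ystar *v wy"
  shows "\<exists>\<delta>s > 0. \<exists>C > 0. \<forall>Yh :: 'n mat.
           symm Yh \<and> rank Yh = 4 \<and> frob_norm (Yh - Ystar) < \<delta>s \<and> PiS Es Yh \<in> calE1 Es \<longrightarrow>
           frob_norm (PY Yh (Rmat k W \<epsilon> (PiS Es Yh)) - Rmat k W \<epsilon> (PiS Es Yh))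
             \<le> C * (frob_norm (Yh - Ystar))\<^sup>2"
proof -
  have unit: "norm (unit_eigvec (A Y) (k + 1)) = 1" "norm (unit_eigvec (A Y) k) = 1"
    if "PiS Es Y \<in> calE1 Es" for Y
    using norm_unit_eigvec_laplacian[OF W that] k unfolding A_def by auto
  obtain a r where a: "0 \<le> a" "0 < r" and near: "\<And>Yh. PiS Es Yh \<in> calE1 Es \<Longrightarrow> norm (Yh - Ystar) < r \<Longrightarrow>
      \<exists>s1 s2 :: real. (s1 = 1 \<or> s1 = -1) \<and> (s2 = 1 \<or> s2 = -1) \<and>
        norm (unit_eigvec (A Yh) (k + 1) - s1 *\<^sub>R unit_eigvec (A Ystar) (k + 1)) \<le> a * norm (Yh - Ystar) \<and>
        norm (unit_eigvec (A Yh) k - s2 *\<^sub>R unit_eigvec (A Ystar) k) \<le> a * norm (Yh - Ystar)"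
    using laplacian_eigvecs_near[OF W E k simple] unfolding A_def by blast
  define C where "C = 3 * (4 * a + norm wz + norm w1 + norm wx + norm wy)\<^sup>2"
  have C_nonneg: "0 \<le> C" unfolding C_def by simp
  show ?thesis
  proof (rule exI[of _ r], intro conjI exI[of _ "C + 1"] allI impI)
    fix Yh :: "'n mat"
    assume "symm Yh \<and> rank Yh = 4 \<and> frob_norm (Yh - Ystar) < r \<and> PiS Es Yh \<in> calE1 Es"
    hence Yh: "transpose Yh = Yh" "rank Yh = 4" "norm (Yh - Ystar) < r" "PiS Es Yh \<in> calE1 Es"
      unfolding symm_def frob_norm_eq_norm by auto
    obtain s1 s2 where s: "s1 = 1 \<or> s1 = -1" "s2 = 1 \<or> s2 = -1"
      "norm (unit_eigvec (A Yh) (k + 1) - s1 *\<^sub>R unit_eigvec (A Ystar) (k + 1)) \<le> a * norm (Yh - Ystar)"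
      "norm (unit_eigvec (A Yh) k - s2 *\<^sub>R unit_eigvec (A Ystar) k) \<le> a * norm (Yh - Ystar)"
      using near[OF Yh(4,3)] by blast
    have "norm (PY Yh (Rmat k W \<epsilon> (PiS Es Yh)) - Rmat k W \<epsilon> (PiS Es Yh)) \<le> C * (norm (Yh - Ystar))\<^sup>2"
      using PY_Rform_defect_quadratic[OF Yh(1,2) unit[OF Yh(4)] unit[OF E] pre s(1,3,2,4) a(1)]
      unfolding Rmat_eq C_def A_def .
    thus "frob_norm (PY Yh (Rmat k W \<epsilon> (PiS Es Yh)) - Rmat k W \<epsilon> (PiS Es Yh))
        \<le> (C + 1) * (frob_norm (Yh - Ystar))\<^sup>2"
      unfolding frob_norm_eq_norm by (smt (verit) mult_right_mono zero_le_power2)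
  qed (use a C_nonneg in auto)
qed

end

theorem lemma4p4:
  fixes Es :: "('n::finite \<times> 'n) set" and W Ystar :: "'n mat"
    and k :: nat and \<epsilon> :: real
  assumes Es_sym: "\<forall>i j. (i, j) \<in> Es \<longrightarrow> (j, i) \<in> Es"
    and W_sym: "symm W"
    and W_nonneg: "\<forall>i j. W$i$j \<ge> 0"
    and W_pattern: "\<forall>i j. (i, j) \<notin> Es \<longrightarrow> W$i$j = 0"
    and k_range: "2 \<le> k" "k \<le> CARD('n) - 1"
    and eps_pos: "\<epsilon> > 0"
    and Ystar_sym: "symm Ystar"
    and Ystar_rank: "rank Ystar = 4"
    and stationary: "ode_rhs Es k W \<epsilon> Ystar = 0"
    and Estar_unit: "PiS Es Ystar \<in> calE1 Es"
    and simple_k: "simple_eig (laplacian (W + \<epsilon> *\<^sub>R PiS Es Ystar)) k"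
    and simple_k1: "simple_eig (laplacian (W + \<epsilon> *\<^sub>R PiS Es Ystar)) (k + 1)"
    and R_rank: "rank (Rmat k W \<epsilon> (PiS Es Ystar)) = 4"
    and PR_nonzero: "PY Ystar (Rmat k W \<epsilon> (PiS Es Ystar)) \<noteq> 0"
  shows "\<exists>\<delta>s > 0. \<exists>C > 0. \<forall>Yh :: 'n mat.
           symm Yh \<and> rank Yh = 4 \<and> frob_norm (Yh - Ystar) < \<delta>s \<and> PiS Es Yh \<in> calE1 Es \<longrightarrow>
           frob_norm (PY Yh (Rmat k W \<epsilon> (PiS Es Yh)) - Rmat k W \<epsilon> (PiS Es Yh))
             \<le> C * (frob_norm (Yh - Ystar))\<^sup>2"
proof -
  have k: "1 \<le> k" "k + 1 \<le> CARD('n)" using k_range by auto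
  obtain wz w1 wx wy where
    "zvec (unit_eigvec (laplacian (W + \<epsilon> *\<^sub>R PiS Es Ystar)) (k + 1))
       (unit_eigvec (laplacian (W + \<epsilon> *\<^sub>R PiS Es Ystar)) k) = Ystar *v wz"
    "one_vec = Ystar *v w1" "unit_eigvec (laplacian (W + \<epsilon> *\<^sub>R PiS Es Ystar)) (k + 1) = Ystar *v wx"
    "unit_eigvec (laplacian (W + \<epsilon> *\<^sub>R PiS Es Ystar)) k = Ystar *v wy"
    using stationary_point_preimages[OF Ystar_sym Ystar_rank stationary R_rank PR_nonzero] .
  thus ?thesis using quadratic_defect_near[OF W_sym Estar_unit k simple_k simple_k1] by blast
qed

end
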